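(* Let $b\ge0$. If $b<x\le a'<a$, then $$Z^{\uparrow}_b(x,a)=Z^{\uparrow}_b(x,a')\,Z^{\uparrow}_b(a',a).$$ Moreover $Z^{\uparrow}_b(x,a)$ is invertible for $b<x\le a$.
   Context: Model. Let $E=\{1,\dots,m\}$; for each $i\in E$ let $c_i>0$, $\lambda_i>0$, $p_i\in(0,1)$, and let $Q=(q_{ij})_{i,j\in E}$ be a stochastic matrix. $(X,J)$ is the Markov process on $[0,\infty)\times E$ with the following dynamics: while the phase $J$ equals $i$, the level $X$ increases linearly with slope $1/c_i$ and the next jump occurs at rate $\lambda_i$; at a jump from $(x,i)$ the process moves to $(p_i x,j)$ with probability $q_{ij}$ ($j=i$ is allowed). $\mathbb E_{x,i}$ denotes expectation given $(X(0),J(0))=(x,i)$. Fix $w>0$. Let $\tau_{\uparrow a}=\inf\{t\ge0:X(t)\ge a\}$ and $\tau_{\downarrow b}=\inf\{t\ge0:X(t)\le b\}$. For $0\le b<a$ the two-sided matrix $Z^{\uparrow}_b(x,a)$ has entries $$(Z^{\uparrow}_b)_{ij}(x,a)=\mathbb E_{x,i}[e^{-w\tau_{\uparrow a}};\tau_{\uparrow a}<\tau_{\downarrow b},J(\tau_{\uparrow a})=j]$$ (infinite $\tau_{\uparrow a}$ contributes $0$), with the convention $Z^{\uparrow}_b(x,a)=0$ for $x\le b$ and $Z^{\uparrow}_b(x,a)=I$ for $x\ge a$. *)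

theory Defs
  imports "HOL-Probability.Probability"
begin

text \<open>
  The phase space is an arbitrary finite type \<open>'e\<close>, so that phase-indexed matrices are elements of
  \<open>real ^ 'e ^ 'e\<close>; the sample space is an arbitrary type \<open>'w\<close>.
\<close>

definition stochastic_matrix :: "real ^ 'e ^ 'e \<Rightarrow> bool" where
  "stochastic_matrix Q \<longleftrightarrow> (\<forall>i j. 0 \<le> Q $ i $ j) \<and> (\<forall>i. (\<Sum>j\<in>UNIV. Q $ i $ j) = 1)"

text \<open>
  \<open>level_phase_process c lam p Q M X J x i\<close>: under the probability measure \<open>M\<close>, the pair \<open>(X, J)\<close>
  is the Markov process with the given dynamics, started in \<open>(x, i)\<close>. Here \<open>T 1 < T 2 < \<dots>\<close> are the
  jump epochs and \<open>T 0 = 0\<close>.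

  Jumps with \<open>j = i\<close> are counted among the epochs. The last clause is the Markovian jump mechanism,
  multiplied out over the first \<open>n\<close> jumps: given the history up to \<open>T k\<close> and \<open>J (T k) = j\<close>, the
  holding time \<open>T (k + 1) - T k\<close> has survival function \<open>t \<mapsto> exp (- lam j * t)\<close> and, independently of
  it, the phase after the jump is \<open>j'\<close> with probability \<open>Q $ j $ j'\<close>. Neither depends on the level,
  and the level is a deterministic functional of the epochs and the phases. The rates being bounded,
  \<open>T n\<close> tends to infinity almost surely; as usual this regularity and \<open>T n < T (n + 1)\<close>
  are required of every path.
\<close>

definition level_phase_process ::
  "('e::finite \<Rightarrow> real) \<Rightarrow> ('e \<Rightarrow> real) \<Rightarrow> ('e \<Rightarrow> real) \<Rightarrow> real ^ 'e ^ 'e \<Rightarrow>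
   'w measure \<Rightarrow> (real \<Rightarrow> 'w \<Rightarrow> real) \<Rightarrow> (real \<Rightarrow> 'w \<Rightarrow> 'e) \<Rightarrow> real \<Rightarrow> 'e \<Rightarrow> bool" where
  "level_phase_process c lam p Q M X J x i \<longleftrightarrow>
     prob_space M \<and>
     (\<exists>T :: nat \<Rightarrow> 'w \<Rightarrow> real.
        (\<forall>n. T n \<in> borel_measurable M) \<and>
        (\<forall>n. (\<lambda>\<omega>. J (T n \<omega>) \<omega>) \<in> measurable M (count_space UNIV)) \<and>
        (\<forall>\<omega>\<in>space M.
           T 0 \<omega> = 0 \<and> strict_mono (\<lambda>n. T n \<omega>) \<and> filterlim (\<lambda>n. T n \<omega>) at_top sequentially \<and>
           X 0 \<omega> = x \<and> J 0 \<omega> = i \<and>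
           (\<forall>n. \<forall>t\<in>{T n \<omega>..<T (Suc n) \<omega>}.
              J t \<omega> = J (T n \<omega>) \<omega> \<and>
              X t \<omega> = X (T n \<omega>) \<omega> + (t - T n \<omega>) / c (J (T n \<omega>) \<omega>)) \<and>
           (\<forall>n. X (T (Suc n) \<omega>) \<omega> =
              p (J (T n \<omega>) \<omega>) *
                (X (T n \<omega>) \<omega> + (T (Suc n) \<omega> - T n \<omega>) / c (J (T n \<omega>) \<omega>)))) \<and>
        (\<forall>n (j :: nat \<Rightarrow> 'e) (t :: nat \<Rightarrow> real). j 0 = i \<and> (\<forall>k<n. 0 \<le> t k) \<longrightarrow>
           measure M {\<omega> \<in> space M. (\<forall>k\<le>n. J (T k \<omega>) \<omega> = j k) \<and>
                                   (\<forall>k<n. t k < T (Suc k) \<omega> - T k \<omega>)} =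
           (\<Prod>k<n. exp (- lam (j k) * t k) * Q $ j k $ j (Suc k))))"

definition tau_up :: "(real \<Rightarrow> 'w \<Rightarrow> real) \<Rightarrow> real \<Rightarrow> 'w \<Rightarrow> ereal" where
  "tau_up X a \<omega> = (INF t\<in>{t. 0 \<le> t \<and> X t \<omega> \<ge> a}. ereal t)"

definition tau_down :: "(real \<Rightarrow> 'w \<Rightarrow> real) \<Rightarrow> real \<Rightarrow> 'w \<Rightarrow> ereal" where
  "tau_down X b \<omega> = (INF t\<in>{t. 0 \<le> t \<and> X t \<omega> \<le> b}. ereal t)"

text \<open>
  \<open>P x i\<close> is the law for the initial state \<open>(x, i)\<close>. The infimum of the empty set is \<open>\<infinity>\<close>, so the
  event \<open>tau_up X a \<omega> < tau_down X b \<omega>\<close> forces \<open>tau_up X a \<omega>\<close> to be finite: infinite passage times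
  contribute 0, and \<open>real_of_ereal\<close> is only relevant at finite values.
\<close>

definition Z_up ::
  "(real \<Rightarrow> 'e::finite \<Rightarrow> 'w measure) \<Rightarrow> (real \<Rightarrow> 'w \<Rightarrow> real) \<Rightarrow> (real \<Rightarrow> 'w \<Rightarrow> 'e) \<Rightarrow>
   real \<Rightarrow> real \<Rightarrow> real \<Rightarrow> real \<Rightarrow> real ^ 'e ^ 'e" where
  "Z_up P X J w b x a =
     (if x \<le> b then 0
      else if a \<le> x then mat 1
      else (\<chi> i j. prob_space.expectation (P x i)
              (\<lambda>\<omega>. if tau_up X a \<omega> < tau_down X b \<omega> \<and> J (real_of_ereal (tau_up X a \<omega>)) \<omega> = j
                   then exp (- w * real_of_ereal (tau_up X a \<omega>)) else 0)))"

end

theory Submission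
  imports Defs
begin

text \<open>
  Conditioning on the first jump shows that the vector \<open>Z_up P X J w b x a\<close> times \<open>g\<close>
  satisfies a renewal equation in \<open>x\<close>. Conversely, along the embedded chain every
  bounded solution \<open>h\<close> of that equation turns into a martingale, namely the gain collected so far plus the
  discounted value of \<open>h\<close> at the current state; letting the number of jumps tend to infinity gives
  \<open>h = Z g\<close>. No Markov property at the passage time is needed: since exponential holding times are
  memoryless, a solution for the target \<open>a\<close> with values \<open>g\<close> also solves the equation for a
  lower target \<open>a'\<close>, with terminal values \<open>h(a')\<close>, and the product formula is the
  representation of this one \<open>h\<close> for both targets. Over a short distance the process most likely does
  not jump, so the matrix is diagonally dominant; a product of such short steps is invertible.
\<close>

subsection \<open>Exponential holding times\<close>

abbreviation exponential_law :: "real \<Rightarrow> real measure" where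
  "exponential_law l \<equiv> density lborel (\<lambda>x. ennreal (exponential_density l x))"

text \<open>This is memorylessness in integral form: after the translation by \<open>r\<close>, the
  exponential density splits off the factor \<open>exp (- l * r)\<close>.\<close>

lemma nn_integral_exponential_shift:
  assumes "0 < l" "0 \<le> r" and [measurable]: "H \<in> borel_measurable borel"
  shows "(\<integral>\<^sup>+s. H s * indicator {r<..} s \<partial>exponential_law l) =
    ennreal (exp (- l * r)) * (\<integral>\<^sup>+s. H (r + s) \<partial>exponential_law l)"
proof -
  have "(\<integral>\<^sup>+s. H s * indicator {r<..} s \<partial>exponential_law l) =
      (\<integral>\<^sup>+s. ennreal (exponential_density l s) * (H s * indicator {r<..} s) \<partial>lborel)"
    by (simp add: nn_integral_density)
  also have "\<dots> = (\<integral>\<^sup>+s. ennreal (exponential_density l (r + s)) * (H (r + s) * indicator {r<..} (r + s)) \<partial>lborel)"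
    by (subst nn_integral_real_affine[where c = 1 and t = r]) auto
  also have "\<dots> = (\<integral>\<^sup>+s. ennreal (exp (- l * r)) * (ennreal (exponential_density l s) * H (r + s)) \<partial>lborel)"
  proof (rule nn_integral_cong_AE)
    \<comment> \<open>The integrands can differ at \<open>s = 0\<close>, where the open indicator
      vanishes but the density does not; the point is a null set.\<close>
    show "AE s in lborel. ennreal (exponential_density l (r + s)) * (H (r + s) * indicator {r<..} (r + s)) =
        ennreal (exp (- l * r)) * (ennreal (exponential_density l s) * H (r + s))"
      using AE_lborel_singleton[of 0]
    proof eventually_elim
      case (elim s)
      show ?case
      proof (cases "0 < s")
        case True
        then have "exponential_density l (r + s) = exp (- l * r) * exponential_density l s"
          using assms by (simp add: exponential_density_def exp_diff exp_minus exp_add field_simps)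
        then show ?thesis
          using True by (simp add: ennreal_mult' mult.assoc)
      next
        case False
        with elim show ?thesis by (simp add: exponential_density_def)
      qed
    qed
  qed
  also have "\<dots> = ennreal (exp (- l * r)) * (\<integral>\<^sup>+s. H (r + s) \<partial>exponential_law l)"
    by (simp add: nn_integral_cmult nn_integral_density)
  finally show ?thesis .
qed

lemma emeasure_exponential_law_greaterThan:
  assumes "0 < l" "0 \<le> r"
  shows "emeasure (exponential_law l) {r<..} = ennreal (exp (- l * r))"
proof -
  interpret prob_space "exponential_law l"
    by (rule prob_space_exponential_density) fact
  show ?thesis
    using nn_integral_exponential_shift[OF assms, of "\<lambda>_. 1"] emeasure_space_1 by simp
qed

text \<open>Either the clock rings by time \<open>r\<close>, or a fresh exponential clock starts at
  \<open>r\<close>.\<close>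

lemma nn_integral_exponential_split:
  assumes "0 < l" "0 \<le> r" and [measurable]: "H \<in> borel_measurable borel"
  shows "(\<integral>\<^sup>+s. H s \<partial>exponential_law l) =
    (\<integral>\<^sup>+s. H s * indicator {..r} s \<partial>exponential_law l) +
    ennreal (exp (- l * r)) * (\<integral>\<^sup>+s. H (r + s) \<partial>exponential_law l)"
proof -
  have "(\<integral>\<^sup>+s. H s \<partial>exponential_law l) =
      (\<integral>\<^sup>+s. H s * indicator {..r} s + H s * indicator {r<..} s \<partial>exponential_law l)"
    by (rule nn_integral_cong) (auto simp: indicator_def)
  also have "\<dots> = (\<integral>\<^sup>+s. H s * indicator {..r} s \<partial>exponential_law l) +
      (\<integral>\<^sup>+s. H s * indicator {r<..} s \<partial>exponential_law l)"
    by (rule nn_integral_add) auto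
  finally show ?thesis
    using nn_integral_exponential_shift[OF assms] by simp
qed

subsection \<open>The renewal equation\<close>

locale level_phase_model =
  fixes c lam p :: "'e::finite \<Rightarrow> real" and Q :: "real ^ 'e ^ 'e" and w b :: real
  assumes c_pos: "0 < c i" and lam_pos: "0 < lam i" and p_pos: "0 < p i" and p_less_1: "p i < 1"
    and Q_stochastic: "stochastic_matrix Q" and w_pos: "0 < w" and b_nonneg: "0 \<le> b"
begin

lemma Q_nonneg: "0 \<le> Q $ i $ j"
  using Q_stochastic by (simp add: stochastic_matrix_def)

lemma Q_row_sum: "(\<Sum>j\<in>UNIV. ennreal (Q $ i $ j)) = 1"
  using Q_stochastic by (subst sum_ennreal) (auto simp: stochastic_matrix_def)

lemma prob_space_exponential_law: "prob_space (exponential_law (lam i))"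
  by (rule prob_space_exponential_density) (rule lam_pos)

text \<open>\<open>s\<close> is the holding time at level \<open>y\<close> in phase \<open>j\<close>, \<open>k\<close> the phase after the jump: either \<open>a\<close>
  is passed before the jump, or the process goes on with value \<open>h\<close>.\<close>

definition step_gain ::
  "real \<Rightarrow> ('e \<Rightarrow> ennreal) \<Rightarrow> ('e \<Rightarrow> real \<Rightarrow> ennreal) \<Rightarrow> 'e \<Rightarrow> 'e \<Rightarrow> real \<Rightarrow> real \<Rightarrow> ennreal" where
  "step_gain a g h j k y s =
     (if a < y + s / c j then ennreal (exp (- w * (c j * (a - y)))) * g j
      else ennreal (exp (- w * s)) * h k (p j * (y + s / c j)))"

text \<open>The product of \<open>Q\<close> and the exponential law reflects that the next phase is
  independent of the holding time. Values in \<open>ennreal\<close> allow iteration and monotone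
  limits without integrability conditions.\<close>

definition step_op ::
  "real \<Rightarrow> ('e \<Rightarrow> ennreal) \<Rightarrow> ('e \<Rightarrow> real \<Rightarrow> ennreal) \<Rightarrow> 'e \<Rightarrow> real \<Rightarrow> ennreal" where
  "step_op a g h j y =
     (\<Sum>k\<in>UNIV. ennreal (Q $ j $ k) * (\<integral>\<^sup>+s. step_gain a g h j k y s \<partial>exponential_law (lam j)))"

lemma step_gain_measurable [measurable (raw)]:
  assumes [measurable]: "\<And>k. h k \<in> borel_measurable borel"
    and [measurable]: "u \<in> borel_measurable M" "v \<in> borel_measurable M"
  shows "(\<lambda>\<omega>. step_gain a g h j k (u \<omega>) (v \<omega>)) \<in> borel_measurable M"
  unfolding step_gain_def by measurable

lemma step_op_measurable [measurable (raw)]: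
  assumes [measurable]: "\<And>k. h k \<in> borel_measurable borel"
  shows "step_op a g h j \<in> borel_measurable borel"
proof -
  interpret prob_space "exponential_law (lam j)"
    by (rule prob_space_exponential_law)
  show ?thesis
    unfolding step_op_def by measurable
qed

text \<open>For \<open>y \<le> a\<close> the climbing time to \<open>a\<close> is nonnegative, and
  so is the holding time almost surely; hence both discount factors are at most 1, and the rows of
  \<open>Q\<close> average with total weight 1.\<close>

lemma step_op_le_1:
  assumes "\<And>k. g k \<le> 1" "\<And>k y. h k y \<le> 1" "y \<le> a"
  shows "step_op a g h j y \<le> 1"
proof -
  interpret prob_space "exponential_law (lam j)"
    by (rule prob_space_exponential_law)
  have "AE s in exponential_law (lam j). 0 \<le> s"
    by (subst AE_density) (auto simp: exponential_density_def)
  then have gain: "AE s in exponential_law (lam j). step_gain a g h j k y s \<le> 1" for k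
  proof eventually_elim
    case (elim s)
    have "0 \<le> w * (c j * (a - y))" "0 \<le> w * s"
      using w_pos c_pos[of j] assms(3) elim by auto
    then have "ennreal (exp (- w * (c j * (a - y)))) \<le> 1" "ennreal (exp (- w * s)) \<le> 1"
      by (auto simp: ennreal_le_1)
    then show ?case
      using assms(1,2) mult_mono[of _ "1::ennreal" _ 1] by (auto simp: step_gain_def)
  qed
  have "(\<integral>\<^sup>+s. step_gain a g h j k y s \<partial>exponential_law (lam j)) \<le> 1" for k
    using nn_integral_mono_AE[OF gain, of k] emeasure_space_1 by simp
  then have "step_op a g h j y \<le> (\<Sum>k\<in>UNIV. ennreal (Q $ j $ k) * 1)"
    unfolding step_op_def by (intro sum_mono mult_left_mono) auto
  then show ?thesis
    by (simp add: Q_row_sum)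
qed

lemma step_op_mono:
  assumes "\<And>k y. h k y \<le> h' k y"
  shows "step_op a g h j y \<le> step_op a g h' j y"
  unfolding step_op_def step_gain_def
  by (intro sum_mono mult_left_mono nn_integral_mono) (auto intro!: mult_left_mono assms)

text \<open>Monotone convergence in the holding time, followed by a finite sum of increasing
  sequences; it carries the iteration in \<open>renewal_solution_exists\<close> to its
  limit.\<close>

lemma step_op_SUP:
  assumes [measurable]: "\<And>n k. h n k \<in> borel_measurable borel" and "incseq h"
  shows "step_op a g (\<lambda>k y. SUP n. h n k y) j y = (SUP n. step_op a g (h n) j y)"
proof -
  have mono: "h m k y \<le> h n k y" if "m \<le> n" for m n k y
    using \<open>incseq h\<close> that by (auto simp: incseq_def le_fun_def)
  have gain_mono: "incseq (\<lambda>n s. step_gain a g (h n) j k y s)" for k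
    by (auto simp: incseq_def le_fun_def step_gain_def intro!: mult_left_mono mono)
  have "step_gain a g (\<lambda>k y. SUP n. h n k y) j k y s = (SUP n. step_gain a g (h n) j k y s)" for k s
    by (simp add: step_gain_def SUP_mult_left_ennreal)
  then have "(\<integral>\<^sup>+s. step_gain a g (\<lambda>k y. SUP n. h n k y) j k y s \<partial>exponential_law (lam j)) =
      (SUP n. \<integral>\<^sup>+s. step_gain a g (h n) j k y s \<partial>exponential_law (lam j))" for k
    by (simp add: nn_integral_monotone_convergence_SUP[OF gain_mono])
  then have "step_op a g (\<lambda>k y. SUP n. h n k y) j y =
      (\<Sum>k\<in>UNIV. SUP n. ennreal (Q $ j $ k) * (\<integral>\<^sup>+s. step_gain a g (h n) j k y s \<partial>exponential_law (lam j)))"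
    by (simp add: step_op_def SUP_mult_left_ennreal)
  also have "\<dots> = (SUP n. step_op a g (h n) j y)"
    unfolding step_op_def
  proof (rule ennreal_SUP_sum[symmetric])
    show "incseq (\<lambda>n. ennreal (Q $ j $ k) * (\<integral>\<^sup>+s. step_gain a g (h n) j k y s \<partial>exponential_law (lam j)))" for k
      using gain_mono[of k]
      by (auto simp: incseq_def le_fun_def intro!: mult_left_mono nn_integral_mono)
  qed
  finally show ?thesis .
qed

text \<open>Cut the holding time at \<open>r\<close>, the time needed to climb from \<open>y\<close>
  to \<open>a'\<close>. If the jump comes before \<open>r\<close>, the targets \<open>a\<close> and
  \<open>a'\<close> give the same gain. Otherwise the clock restarts at \<open>a'\<close> in the
  unchanged phase \<open>j\<close>, and the restarted value is exactly the terminal value prescribed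
  at \<open>a'\<close>.\<close>

lemma step_op_memoryless:
  assumes [measurable]: "\<And>k. h k \<in> borel_measurable borel"
    and "y \<le> a'" "a' \<le> a"
  shows "step_op a g h j y = step_op a' (\<lambda>k. step_op a g h k a') h j y"
proof -
  define r where "r = c j * (a' - y)"
  have r: "0 \<le> r" using c_pos[of j] assms by (simp add: r_def)
  have r': "a' < y + s / c j \<longleftrightarrow> r < s" for s
    using c_pos[of j] by (simp add: r_def field_simps)
  \<comment> \<open>The probability of no jump up to time \<open>r\<close>, times the discount over
    that time.\<close>
  let ?E = "ennreal (exp (- lam j * r)) * ennreal (exp (- w * r))"
  let ?I = "\<lambda>a g k y. \<integral>\<^sup>+s. step_gain a g h j k y s \<partial>exponential_law (lam j)"
  let ?L = "\<lambda>k. \<integral>\<^sup>+s. step_gain a g h j k y s * indicator {..r} s \<partial>exponential_law (lam j)"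
  let ?g = "\<lambda>k. step_op a g h k a'"
  interpret E: prob_space "exponential_law (lam j)"
    by (rule prob_space_exponential_law)
  have low: "step_gain a' ?g h j k y s * indicator {..r} s = step_gain a g h j k y s * indicator {..r} s" for k s
  proof (cases "s \<le> r")
    case True
    then have "\<not> a' < y + s / c j" using r' by (simp add: not_less)
    then show ?thesis using \<open>a' \<le> a\<close> by (simp add: step_gain_def)
  qed simp
  have "step_gain a g h j k y (r + s) = ennreal (exp (- w * r)) * step_gain a g h j k a' s" for k s
  proof -
    have 1: "y + (r + s) / c j = a' + s / c j"
      using c_pos[of j] by (simp add: r_def field_simps)
    have 2: "exp (- w * (c j * (a - y))) = exp (- w * r) * exp (- w * (c j * (a - a')))"
      by (simp add: r_def exp_add[symmetric] algebra_simps)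
    have 3: "exp (- w * (r + s)) = exp (- w * r) * exp (- w * s)"
      by (simp add: exp_add[symmetric] algebra_simps)
    show ?thesis
      unfolding step_gain_def 1 2 3 by (simp add: ennreal_mult' mult.assoc)
  qed
  then have 1: "?I a g k y = ?L k + ?E * ?I a g k a'" for k
    using r lam_pos[of j] by (subst nn_integral_exponential_split[where r = r]) (auto simp: nn_integral_cmult mult.assoc)
  \<comment> \<open>At \<open>s = 0\<close> the level is exactly \<open>a'\<close>, which the strict
    test in \<open>step_gain\<close> does not count as passed.\<close>
  have "AE s in exponential_law (lam j). 0 < s"
    using AE_lborel_singleton[of 0] by (subst AE_density) (auto simp: exponential_density_def)
  then have "(\<integral>\<^sup>+s. step_gain a' ?g h j k y (r + s) \<partial>exponential_law (lam j)) =
      (\<integral>\<^sup>+s. ennreal (exp (- w * r)) * ?g j \<partial>exponential_law (lam j))" for k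
    by (intro nn_integral_cong_AE) (auto simp: step_gain_def r' r_def elim: eventually_mono)
  then have 2: "?I a' ?g k y = ?L k + ?E * ?g j" for k
    using r lam_pos[of j] E.emeasure_space_1
    by (subst nn_integral_exponential_split[where r = r]) (auto simp: low mult.assoc)
  have "step_op a g h j y = (\<Sum>k\<in>UNIV. ennreal (Q $ j $ k) * ?L k) + ?E * ?g j"
    unfolding step_op_def[of a g h j] 1
    by (simp add: distrib_left sum.distrib sum_distrib_left mult_ac)
  \<comment> \<open>The restart term does not depend on the next phase, so the row sum 1 can be
    inserted to bring it under the sum over \<open>k\<close>.\<close>
  also have "\<dots> = (\<Sum>k\<in>UNIV. ennreal (Q $ j $ k) * ?L k) + (\<Sum>k\<in>UNIV. ennreal (Q $ j $ k)) * (?E * ?g j)"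
    by (simp add: Q_row_sum)
  also have "\<dots> = step_op a' ?g h j y"
    unfolding step_op_def[of a' ?g] 2
    by (simp add: distrib_left sum.distrib sum_distrib_right)
  finally show ?thesis .
qed

text \<open>The zero values up to \<open>b\<close> encode killing, and the bound 1 makes the
  remainder vanish after many jumps. Above \<open>a\<close> no equation is imposed, so the same
  \<open>h\<close> can serve for a lower target.\<close>

definition renewal_solution ::
  "real \<Rightarrow> ('e \<Rightarrow> ennreal) \<Rightarrow> ('e \<Rightarrow> real \<Rightarrow> ennreal) \<Rightarrow> bool" where
  "renewal_solution a g h \<longleftrightarrow>
     (\<forall>k. h k \<in> borel_measurable borel) \<and> (\<forall>k y. h k y \<le> 1) \<and> (\<forall>k. \<forall>y\<le>b. h k y = 0) \<and>
     (\<forall>k y. b < y \<and> y \<le> a \<longrightarrow> h k y = step_op a g h k y)"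

text \<open>Monotone iteration from 0: the iterates increase and stay below 1, and their supremum is
  a fixed point.\<close>

lemma renewal_solution_exists:
  assumes "\<And>k. g k \<le> 1"
  shows "\<exists>h. renewal_solution a g h"
proof -
  \<comment> \<open>Below \<open>b\<close> the value 0 is forced; above \<open>a\<close> it is only
    a default.\<close>
  define \<Phi> where "\<Phi> h k y = (if b < y \<and> y \<le> a then step_op a g h k y else 0)" for h k y
  define f where "f n = (\<Phi> ^^ n) (\<lambda>_ _. 0)" for n
  have f_0: "f 0 = (\<lambda>_ _. 0)" and f_Suc: "f (Suc n) = \<Phi> (f n)" for n
    by (simp_all add: f_def)
  have meas [measurable]: "f n k \<in> borel_measurable borel" for n k
  proof (induction n arbitrary: k)
    case (Suc n)
    note [measurable] = Suc.IH
    have "(\<lambda>y. \<Phi> (f n) k y) \<in> borel_measurable borel"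
      unfolding \<Phi>_def by measurable
    then show ?case by (simp add: f_Suc)
  qed (simp add: f_0)
  have le_1: "f n k y \<le> 1" for n k y
  proof (induction n arbitrary: k y)
    case (Suc n)
    then show ?case using step_op_le_1[OF assms Suc.IH] by (simp add: f_Suc \<Phi>_def)
  qed (simp add: f_0)
  have "f n \<le> f (Suc n)" for n
  proof (induction n)
    case (Suc n)
    then show ?case
      by (auto simp: f_Suc \<Phi>_def le_fun_def intro!: step_op_mono)
  qed (simp add: f_0 le_fun_def)
  then have inc: "incseq f"
    by (rule incseq_SucI)
  define h where "h k y = (SUP n. f n k y)" for k y
  have "h k y = 0" if "y \<le> b" for k y
  proof -
    have "f n k y = 0" for n
      using that by (cases n) (auto simp: f_0 f_Suc \<Phi>_def)
    then show ?thesis by (simp add: h_def)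
  qed
  moreover have "h k y = step_op a g h k y" if "b < y" "y \<le> a" for k y
  proof -
    have "step_op a g h k y = (SUP n. step_op a g (f n) k y)"
      using step_op_SUP[OF meas inc] by (simp add: h_def[abs_def])
    also have "\<dots> = (SUP n. f (Suc n) k y)"
      using that by (simp add: f_Suc \<Phi>_def)
    also have "\<dots> = h k y"
      unfolding h_def
    proof (rule antisym)
      show "(SUP n. f (Suc n) k y) \<le> (SUP n. f n k y)"
        by (rule SUP_least) (rule SUP_upper, simp)
      show "(SUP n. f n k y) \<le> (SUP n. f (Suc n) k y)"
        using inc by (intro SUP_mono) (auto simp: incseq_Suc_iff le_fun_def)
    qed
    finally show ?thesis by simp
  qed
  moreover have "h k \<in> borel_measurable borel" "h k y \<le> 1" for k y
    using le_1 by (auto simp: h_def[abs_def] intro: SUP_least)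
  ultimately show ?thesis
    unfolding renewal_solution_def by blast
qed

text \<open>This is the analytic core of the product formula. As \<open>b < a' \<le> a\<close>, the
  renewal equation holds at \<open>a'\<close> itself, so the terminal values in
  \<open>step_op_memoryless\<close> are the values of \<open>h\<close> there.\<close>

lemma renewal_solution_lower_end:
  assumes "renewal_solution a g h" "b < a'" "a' \<le> a"
  shows "renewal_solution a' (\<lambda>k. h k a') h"
proof -
  have [measurable]: "\<And>k. h k \<in> borel_measurable borel"
    using assms by (simp add: renewal_solution_def)
  have h: "h k y = step_op a g h k y" if "b < y" "y \<le> a" for k y
    using assms that unfolding renewal_solution_def by blast
  have "h k y = step_op a' (\<lambda>k. h k a') h k y" if "b < y" "y \<le> a'" for k y
  proof -
    have "(\<lambda>k. h k a') = (\<lambda>k. step_op a g h k a')"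
      using h assms by blast
    then show ?thesis
      using step_op_memoryless[of h y a' a g k] h[of y k] that assms by (simp only:) simp
  qed
  then show ?thesis
    using assms(1) unfolding renewal_solution_def by blast
qed

text \<open>Only the event that no jump occurs before \<open>a\<close> is reached is kept: it has
  probability \<open>exp (- lam j * r)\<close>, its gain is \<open>g j\<close>, and the discount is
  \<open>exp (- w * r)\<close>.\<close>

lemma renewal_solution_lower_bound:
  assumes "renewal_solution a g h" "b < y" "y \<le> a"
  shows "ennreal (exp (- (lam j + w) * (c j * (a - y)))) * g j \<le> h j y"
proof -
  interpret E: prob_space "exponential_law (lam j)"
    by (rule prob_space_exponential_law)
  define r where "r = c j * (a - y)"
  have r: "0 \<le> r" using c_pos[of j] assms by (simp add: r_def)
  have meas [measurable]: "\<And>k. h k \<in> borel_measurable borel"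
    using assms by (simp add: renewal_solution_def)
  have "ennreal (exp (- (lam j + w) * (c j * (a - y)))) * g j =
      (\<integral>\<^sup>+s. ennreal (exp (- w * r)) * g j * indicator {r<..} s \<partial>exponential_law (lam j))" (is "?E = _")
  proof -
    have "?E = ennreal (exp (- w * r)) * g j * ennreal (exp (- lam j * r))"
      by (simp add: r_def mult_ac ennreal_mult'[symmetric] exp_add[symmetric] algebra_simps)
    then show ?thesis
      by (simp only: nn_integral_cmult_indicator sets_density sets_lborel greaterThan_borel
          emeasure_exponential_law_greaterThan[OF lam_pos[of j] r])
  qed
  \<comment> \<open>The bound is the same for every next phase \<open>k\<close>, so averaging over a
    row of \<open>Q\<close> preserves it.\<close>
  also have "\<dots> \<le> (\<integral>\<^sup>+s. step_gain a g h j k y s \<partial>exponential_law (lam j))" for k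
    using c_pos[of j]
    by (intro nn_integral_mono) (auto simp: step_gain_def r_def indicator_def field_simps)
  finally have "(\<Sum>k\<in>UNIV. ennreal (Q $ j $ k) * ?E) \<le> step_op a g h j y"
    unfolding step_op_def by (intro sum_mono mult_left_mono) auto
  then show ?thesis
    using assms by (simp add: sum_distrib_right[symmetric] Q_row_sum renewal_solution_def)
qed

end

subsection \<open>Embedded chain of a single law\<close>

text \<open>The existential over the epochs in \<open>level_phase_process\<close> is opened with a
  fixed witness \<open>T\<close>, which makes the embedded chain available as constants.\<close>

locale level_phase_epochs = level_phase_model c lam p Q w b + prob_space M
  for c lam p :: "'e::finite \<Rightarrow> real" and Q :: "real ^ 'e ^ 'e" and w b :: real and M :: "'w measure" +
  fixes X :: "real \<Rightarrow> 'w \<Rightarrow> real" and J :: "real \<Rightarrow> 'w \<Rightarrow> 'e" and x :: real and i :: 'e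
    and T :: "nat \<Rightarrow> 'w \<Rightarrow> real"
  assumes T_measurable: "T n \<in> borel_measurable M"
    and J_T_measurable: "(\<lambda>\<omega>. J (T n \<omega>) \<omega>) \<in> measurable M (count_space UNIV)"
    and T_0: "\<omega> \<in> space M \<Longrightarrow> T 0 \<omega> = 0"
    and T_strict_mono: "\<omega> \<in> space M \<Longrightarrow> strict_mono (\<lambda>n. T n \<omega>)"
    and T_at_top: "\<omega> \<in> space M \<Longrightarrow> filterlim (\<lambda>n. T n \<omega>) at_top sequentially"
    and X_0: "\<omega> \<in> space M \<Longrightarrow> X 0 \<omega> = x"
    and J_0: "\<omega> \<in> space M \<Longrightarrow> J 0 \<omega> = i"
    and J_between: "\<omega> \<in> space M \<Longrightarrow> T n \<omega> \<le> s \<Longrightarrow> s < T (Suc n) \<omega> \<Longrightarrow> J s \<omega> = J (T n \<omega>) \<omega>"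
    and X_between: "\<omega> \<in> space M \<Longrightarrow> T n \<omega> \<le> s \<Longrightarrow> s < T (Suc n) \<omega> \<Longrightarrow>
      X s \<omega> = X (T n \<omega>) \<omega> + (s - T n \<omega>) / c (J (T n \<omega>) \<omega>)"
    and X_jump: "\<omega> \<in> space M \<Longrightarrow> X (T (Suc n) \<omega>) \<omega> =
      p (J (T n \<omega>) \<omega>) * (X (T n \<omega>) \<omega> + (T (Suc n) \<omega> - T n \<omega>) / c (J (T n \<omega>) \<omega>))"
    and cylinder_law: "j 0 = i \<Longrightarrow> (\<And>k. k < n \<Longrightarrow> 0 \<le> t k) \<Longrightarrow>
      prob {\<omega> \<in> space M. (\<forall>k\<le>n. J (T k \<omega>) \<omega> = j k) \<and> (\<forall>k<n. t k < T (Suc k) \<omega> - T k \<omega>)} =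
      (\<Prod>k<n. exp (- lam (j k) * t k) * Q $ j k $ j (Suc k))"
begin

definition phase :: "nat \<Rightarrow> 'w \<Rightarrow> 'e" where "phase n \<omega> = J (T n \<omega>) \<omega>"

definition level :: "nat \<Rightarrow> 'w \<Rightarrow> real" where "level n \<omega> = X (T n \<omega>) \<omega>"

definition hold :: "nat \<Rightarrow> 'w \<Rightarrow> real" where "hold n \<omega> = T (Suc n) \<omega> - T n \<omega>"

text \<open>The left limit of the level at the next epoch; the path stays strictly below it during
  the sojourn.\<close>

definition peak :: "nat \<Rightarrow> 'w \<Rightarrow> real" where "peak n \<omega> = level n \<omega> + hold n \<omega> / c (phase n \<omega>)"

lemma phase_0: "\<omega> \<in> space M \<Longrightarrow> phase 0 \<omega> = i"
  and level_0: "\<omega> \<in> space M \<Longrightarrow> level 0 \<omega> = x"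
  and level_Suc: "\<omega> \<in> space M \<Longrightarrow> level (Suc n) \<omega> = p (phase n \<omega>) * peak n \<omega>"
  by (simp_all add: phase_def level_def peak_def hold_def T_0 X_0 J_0 X_jump)

lemma hold_pos: "\<omega> \<in> space M \<Longrightarrow> 0 < hold n \<omega>"
  using T_strict_mono by (simp add: hold_def strict_mono_Suc_iff)

lemma T_Suc: "T (Suc n) \<omega> = T n \<omega> + hold n \<omega>"
  by (simp add: hold_def)

lemma phase_measurable [measurable]: "phase n \<in> measurable M (count_space UNIV)"
  unfolding phase_def by (rule J_T_measurable)

lemma hold_measurable [measurable]: "hold n \<in> borel_measurable M"
  unfolding hold_def[abs_def] using T_measurable by measurable

text \<open>Sets of phases in place of single phases make the family closed under intersection, and
  the whole space becomes a box.\<close>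

definition box :: "nat \<Rightarrow> (nat \<Rightarrow> 'e set) \<Rightarrow> (nat \<Rightarrow> real) \<Rightarrow> 'w set" where
  "box n K t = {\<omega> \<in> space M. (\<forall>k\<le>n. phase k \<omega> \<in> K k) \<and> (\<forall>k<n. t k < hold k \<omega>)}"

lemma box_sets [measurable]: "box n K t \<in> sets M"
proof -
  have "box n K t = {\<omega> \<in> space M. (\<forall>k\<in>{..n}. phase k \<omega> \<in> K k) \<and> (\<forall>k\<in>{..<n}. t k < hold k \<omega>)}"
    by (auto simp: box_def)
  also have "\<dots> \<in> sets M" by measurable
  finally show ?thesis .
qed

text \<open>A box is the disjoint union of its single-phase cylinders. Extensional functions on
  \<open>{..n}\<close> list each phase sequence once, and sequences not starting in \<open>i\<close>
  give the empty event.\<close>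

lemma prob_box:
  assumes "\<And>k. k < n \<Longrightarrow> 0 \<le> t k"
  shows "prob (box n K t) = (\<Sum>js\<in>Pi\<^sub>E {..n} K. if js 0 = i then
    (\<Prod>k<n. exp (- lam (js k) * t k) * Q $ js k $ js (Suc k)) else 0)"
proof -
  have "box n K t = (\<Union>js\<in>Pi\<^sub>E {..n} K. box n (\<lambda>k. {js k}) t)"
  proof (intro antisym subsetI)
    fix \<omega> assume \<omega>: "\<omega> \<in> box n K t"
    then have "restrict (\<lambda>k. phase k \<omega>) {..n} \<in> Pi\<^sub>E {..n} K"
      by (auto simp: box_def)
    moreover have "\<omega> \<in> box n (\<lambda>k. {restrict (\<lambda>k. phase k \<omega>) {..n} k}) t"
      using \<omega> by (auto simp: box_def)
    ultimately show "\<omega> \<in> (\<Union>js\<in>Pi\<^sub>E {..n} K. box n (\<lambda>k. {js k}) t)" by blast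
  qed (auto simp: box_def PiE_def Pi_def)
  moreover have "disjoint_family_on (\<lambda>js. box n (\<lambda>k. {js k}) t) (Pi\<^sub>E {..n} K)"
    unfolding disjoint_family_on_def
  proof (intro ballI impI)
    fix js js' assume "js \<in> Pi\<^sub>E {..n} K" "js' \<in> Pi\<^sub>E {..n} K" "js \<noteq> js'"
    then obtain k where "k \<le> n" "js k \<noteq> js' k"
      by (metis PiE_ext atMost_iff)
    then show "box n (\<lambda>k. {js k}) t \<inter> box n (\<lambda>k. {js' k}) t = {}"
      by (auto simp: box_def)
  qed
  ultimately have "prob (box n K t) = (\<Sum>js\<in>Pi\<^sub>E {..n} K. prob (box n (\<lambda>k. {js k}) t))"
    by (simp add: finite_measure_finite_Union finite_PiE image_subset_iff)
  also have "\<dots> = (\<Sum>js\<in>Pi\<^sub>E {..n} K. if js 0 = i then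
    (\<Prod>k<n. exp (- lam (js k) * t k) * Q $ js k $ js (Suc k)) else 0)"
  proof (rule sum.cong[OF refl])
    fix js assume "js \<in> Pi\<^sub>E {..n} K"
    show "prob (box n (\<lambda>k. {js k}) t) =
      (if js 0 = i then (\<Prod>k<n. exp (- lam (js k) * t k) * Q $ js k $ js (Suc k)) else 0)"
    proof (cases "js 0 = i")
      case True
      then show ?thesis
        using cylinder_law[of js n t] assms by (simp add: box_def phase_def hold_def)
    next
      case False
      then have "box n (\<lambda>k. {js k}) t = {}"
        by (auto simp: box_def phase_0 intro!: exI[of _ 0])
      then show ?thesis using False by simp
    qed
  qed
  finally show ?thesis .
qed

lemma box_Suc:
  "box (Suc n) (K(Suc n := {j})) (t(n := u)) =
    box n K t \<inter> {\<omega> \<in> space M. phase (Suc n) \<omega> = j \<and> u < hold n \<omega>}"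
proof -
  have "(\<forall>k\<le>Suc n. phase k \<omega> \<in> (K(Suc n := {j})) k) \<longleftrightarrow>
      (\<forall>k\<le>n. phase k \<omega> \<in> K k) \<and> phase (Suc n) \<omega> = j" for \<omega>
    by (auto simp: le_Suc_eq)
  moreover have "(\<forall>k<Suc n. (t(n := u)) k < hold k \<omega>) \<longleftrightarrow> (\<forall>k<n. t k < hold k \<omega>) \<and> u < hold n \<omega>" for \<omega>
    by (auto simp: less_Suc_eq)
  ultimately show ?thesis
    unfolding box_def by blast
qed

text \<open>The factor added for holding time \<open>n\<close> and phase \<open>Suc n\<close>
  depends only on phase \<open>n\<close>; pinning that phase to \<open>j\<close> makes it constant
  over the sum. Sequences up to \<open>Suc n\<close> ending in \<open>j'\<close> correspond to
  sequences up to \<open>n\<close>.\<close>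

lemma prob_box_Suc:
  assumes "\<And>k. k < n \<Longrightarrow> 0 \<le> t k" "0 \<le> u" "K n \<subseteq> {j}"
  shows "prob (box (Suc n) (K(Suc n := {j'})) (t(n := u))) =
    prob (box n K t) * (exp (- lam j * u) * Q $ j $ j')"
proof -
  let ?K = "K(Suc n := {j'})" and ?t = "t(n := u)"
  let ?F = "\<lambda>n t js. if js 0 = i then (\<Prod>k<n. exp (- lam (js k) * t k) * Q $ js k $ js (Suc k)) else 0"
  have "prob (box (Suc n) ?K ?t) = (\<Sum>js\<in>Pi\<^sub>E {..Suc n} ?K. ?F (Suc n) ?t js)"
    using assms by (intro prob_box) (auto simp: less_Suc_eq)
  also have "\<dots> = (\<Sum>js\<in>Pi\<^sub>E {..n} K. ?F n t js * (exp (- lam j * u) * Q $ j $ j'))"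
  proof (rule sum.reindex_bij_witness[where i = "\<lambda>js. js(Suc n := j')" and j = "\<lambda>js. restrict js {..n}"])
    fix js assume js: "js \<in> Pi\<^sub>E {..Suc n} ?K"
    then have "js (Suc n) = j'" by (auto simp: PiE_def Pi_def)
    moreover have "js k = undefined" if "Suc n < k" for k
      using js that by (auto simp: PiE_def extensional_def)
    ultimately show "(restrict js {..n})(Suc n := j') = js"
      by (intro ext, rename_tac k, case_tac "k \<le> n"; case_tac "k = Suc n") auto
    have js_K: "js k \<in> K k" if "k \<le> n" for k
      using PiE_mem[OF js, of k] that by simp
    then show "restrict js {..n} \<in> Pi\<^sub>E {..n} K"
      by auto
    have "js n = j"
      using js_K[of n] assms(3) by auto
    then show "?F n t (restrict js {..n}) * (exp (- lam j * u) * Q $ j $ j') = ?F (Suc n) ?t js"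
      using \<open>js (Suc n) = j'\<close> by (auto intro!: prod.cong)
  next
    fix js assume js: "js \<in> Pi\<^sub>E {..n} K"
    show "restrict (js(Suc n := j')) {..n} = js"
      using js by (auto simp: PiE_def extensional_def restrict_def)
    show "js(Suc n := j') \<in> Pi\<^sub>E {..Suc n} ?K"
      using js by (auto simp: PiE_def extensional_def Pi_def le_Suc_eq)
  qed
  also have "\<dots> = prob (box n K t) * (exp (- lam j * u) * Q $ j $ j')"
    using assms by (simp add: prob_box sum_distrib_right)
  finally show ?thesis .
qed

section \<open>The history sigma-algebras and their measurable functions\<close>

definition box_family :: "nat \<Rightarrow> 'w set set" where
  "box_family n = {box n K t | K t. \<forall>k<n. 0 \<le> t k}"

text \<open>The history up to the \<open>n\<close>-th epoch; it does not contain the \<open>n\<close>-th holding time.\<close>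

definition history :: "nat \<Rightarrow> 'w measure" where
  "history n = sigma (space M) (box_family n)"

lemma box_family_Pow: "box_family n \<subseteq> Pow (space M)"
  by (auto simp: box_family_def box_def)

lemma space_history [simp]: "space (history n) = space M"
  using box_family_Pow by (simp add: history_def)

lemma sets_history: "sets (history n) = sigma_sets (space M) (box_family n)"
  using box_family_Pow by (simp add: history_def)

lemma space_in_box_family: "space M \<in> box_family n"
proof -
  have "box n (\<lambda>_. UNIV) (\<lambda>_. 0) = space M"
    by (auto simp: box_def hold_pos)
  then show ?thesis
    unfolding box_family_def by force
qed

lemma Int_stable_box_family: "Int_stable (box_family n)"
proof (rule Int_stableI)
  fix A B assume "A \<in> box_family n" "B \<in> box_family n"
  then obtain K t K' t' where A: "A = box n K t" "\<forall>k<n. 0 \<le> t k" and B: "B = box n K' t'" "\<forall>k<n. 0 \<le> t' k"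
    by (auto simp: box_family_def)
  have "A \<inter> B = box n (\<lambda>k. K k \<inter> K' k) (\<lambda>k. max (t k) (t' k))"
    by (auto simp: A B box_def)
  moreover have "\<forall>k<n. 0 \<le> max (t k) (t' k)"
    using A(2) by (auto simp: le_max_iff_disj)
  ultimately show "A \<inter> B \<in> box_family n"
    unfolding box_family_def by blast
qed

lemma sets_history_subset: "sets (history n) \<subseteq> sets M"
  unfolding sets_history by (rule sets.sigma_sets_subset) (auto simp: box_family_def)

lemma measurable_history_imp: "f \<in> measurable (history n) N \<Longrightarrow> f \<in> measurable M N"
  using sets_history_subset[of n] by (auto simp: measurable_def)

text \<open>Pushing a measure forward along this identity map restricts it to the history.\<close>

lemma ident_history_measurable: "(\<lambda>\<omega>. \<omega>) \<in> measurable M (history n)"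
  using sets_history_subset[of n] by (auto simp: measurable_def)

lemma phase_history:
  assumes "k \<le> n"
  shows "phase k \<in> measurable (history n) (count_space UNIV)"
proof -
  have "phase k -` A \<inter> space (history n) \<in> sets (history n)" for A
  proof -
    have "phase k -` A \<inter> space (history n) = box n (\<lambda>l. if l = k then A else UNIV) (\<lambda>_. 0)"
      using assms by (auto simp: box_def hold_pos)
    moreover have "\<dots> \<in> box_family n"
      unfolding box_family_def by force
    ultimately show ?thesis
      by (auto simp: sets_history)
  qed
  then show ?thesis by (intro measurableI) auto
qed

lemma hold_history:
  assumes "k < n"
  shows "hold k \<in> borel_measurable (history n)"
  unfolding borel_measurable_iff_greater
proof (intro allI)
  fix u
  \<comment> \<open>Thresholds of boxes must be nonnegative. Replacing \<open>u\<close> by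
    \<open>max 0 u\<close> changes nothing because holding times are positive.\<close>
  have "{\<omega> \<in> space (history n). u < hold k \<omega>} = box n (\<lambda>_. UNIV) (\<lambda>l. if l = k then max 0 u else 0)"
    using assms by (auto simp: box_def hold_pos split: if_splits)
  moreover have "\<dots> \<in> box_family n"
    unfolding box_family_def by force
  ultimately show "{\<omega> \<in> space (history n). u < hold k \<omega>} \<in> sets (history n)"
    by (auto simp: sets_history)
qed

lemma level_history:
  assumes "k \<le> n"
  shows "level k \<in> borel_measurable (history n)"
  using assms
proof (induction k)
  case 0
  then show ?case
    using measurable_cong[of "history n" "level 0" "\<lambda>_. x" borel] by (simp add: level_0)
next
  case (Suc k)
  have [measurable]: "phase k \<in> measurable (history n) (count_space UNIV)"
    "hold k \<in> borel_measurable (history n)" "level k \<in> borel_measurable (history n)"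
    using Suc by (auto intro: phase_history hold_history)
  have "(\<lambda>\<omega>. p (phase k \<omega>) * peak k \<omega>) \<in> borel_measurable (history n)"
    unfolding peak_def by measurable
  then show ?case
    using measurable_cong[of "history n" "level (Suc k)" "\<lambda>\<omega>. p (phase k \<omega>) * peak k \<omega>" borel]
    by (simp add: level_Suc)
qed

lemma T_history:
  assumes "k \<le> n"
  shows "T k \<in> borel_measurable (history n)"
  using assms
proof (induction k)
  case 0
  then show ?case
    using measurable_cong[of "history n" "T 0" "\<lambda>_. 0" borel] by (simp add: T_0)
next
  case (Suc k)
  then have [measurable]: "hold k \<in> borel_measurable (history n)" "T k \<in> borel_measurable (history n)"
    by (auto intro: hold_history)
  show ?case unfolding T_Suc[abs_def] by measurable
qed

section \<open>The Markov property at the jump epochs\<close>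

definition phase_at :: "nat \<Rightarrow> 'e \<Rightarrow> 'w set" where
  "phase_at n j = {\<omega> \<in> space M. phase n \<omega> = j}"

definition move :: "nat \<Rightarrow> 'e \<Rightarrow> 'e \<Rightarrow> 'w set" where
  "move n j j' = {\<omega> \<in> space M. phase n \<omega> = j \<and> phase (Suc n) \<omega> = j'}"

lemma phase_at_sets [measurable]: "phase_at n j \<in> sets M"
  and move_sets [measurable]: "move n j j' \<in> sets M"
  unfolding phase_at_def move_def by measurable

text \<open>For boxes this is \<open>prob_box_Suc\<close>. Both sides are finite measures in
  \<open>A\<close>, and boxes form an intersection-stable generator containing the space, so the
  identity extends to the whole history.\<close>

lemma emeasure_history_tail:
  assumes A: "A \<in> sets (history n)" and "0 \<le> u"
  shows "emeasure M (A \<inter> move n j j' \<inter> {\<omega> \<in> space M. u < hold n \<omega>}) =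
    emeasure M (A \<inter> phase_at n j) * ennreal (exp (- lam j * u) * Q $ j $ j')"
proof -
  let ?V = "move n j j' \<inter> {\<omega> \<in> space M. u < hold n \<omega>}"
  define e where "e = ennreal (exp (- lam j * u) * Q $ j $ j')"
  define N1 where "N1 = distr (density M (indicator ?V)) (history n) (\<lambda>\<omega>. \<omega>)"
  define N2 where "N2 = distr (density M (\<lambda>\<omega>. e * indicator (phase_at n j) \<omega>)) (history n) (\<lambda>\<omega>. \<omega>)"
  have V [measurable]: "?V \<in> sets M" by measurable
  have em: "emeasure N1 A = emeasure M (A \<inter> ?V)" "emeasure N2 A = emeasure M (A \<inter> phase_at n j) * e"
    if "A \<in> sets (history n)" for A
  proof -
    have [measurable]: "A \<in> sets M" using that sets_history_subset by blast
    have [simp]: "A \<inter> space M = A" using sets.sets_into_space[of A M] by auto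
    show "emeasure N1 A = emeasure M (A \<inter> ?V)"
      unfolding N1_def using that ident_history_measurable[of n]
      by (subst emeasure_distr) (simp_all add: emeasure_density nn_integral_indicator indicator_inter_arith[symmetric] Int_commute del: Int_iff)
    have e_indicator: "e * indicator (phase_at n j) \<omega> * indicator A \<omega> = e * indicator (A \<inter> phase_at n j) \<omega>" for \<omega>
      by (simp split: split_indicator)
    show "emeasure N2 A = emeasure M (A \<inter> phase_at n j) * e"
      unfolding N2_def using that ident_history_measurable[of n]
      by (subst emeasure_distr) (simp_all add: emeasure_density e_indicator nn_integral_cmult_indicator
        mult.commute[of e "emeasure M _"])
  qed
  have "N1 = N2"
  proof (rule measure_eqI_generator_eq[OF Int_stable_box_family box_family_Pow, where A = "\<lambda>_. space M"])
    show "sets N1 = sigma_sets (space M) (box_family n)" "sets N2 = sigma_sets (space M) (box_family n)"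
      by (simp_all add: N1_def N2_def sets_history)
    show "range (\<lambda>_. space M) \<subseteq> box_family n"
      using space_in_box_family by auto
    show "emeasure N1 (space M) \<noteq> \<infinity>"
      using em(1)[of "space M"] sets.top[of "history n"] by simp
    fix A assume "A \<in> box_family n"
    then obtain K t where A: "A = box n K t" "\<And>k. k < n \<Longrightarrow> 0 \<le> t k"
      by (auto simp: box_family_def)
    \<comment> \<open>Intersecting with the event that phase \<open>n\<close> is \<open>j\<close>
      gives a box again, now with the pinned phase that \<open>prob_box_Suc\<close>
      requires.\<close>
    define K' where "K' = K(n := K n \<inter> {j})"
    have 1: "A \<inter> phase_at n j = box n K' t"
      by (auto simp: A(1) K'_def box_def phase_at_def)
    have 2: "A \<inter> ?V = box (Suc n) (K'(Suc n := {j'})) (t(n := u))"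
    proof -
      have "A \<inter> ?V = box n K' t \<inter> {\<omega> \<in> space M. phase (Suc n) \<omega> = j' \<and> u < hold n \<omega>}"
        unfolding 1[symmetric] by (auto simp: move_def phase_at_def)
      then show ?thesis by (simp add: box_Suc)
    qed
    have "prob (A \<inter> ?V) = prob (A \<inter> phase_at n j) * (exp (- lam j * u) * Q $ j $ j')"
      unfolding 1 2 by (rule prob_box_Suc) (auto simp: A \<open>0 \<le> u\<close> K'_def)
    then have "emeasure M (A \<inter> ?V) = emeasure M (A \<inter> phase_at n j) * e"
      by (simp add: emeasure_eq_measure ennreal_mult' Q_nonneg e_def)
    moreover have "A \<in> sets (history n)"
      using \<open>A \<in> box_family n\<close> by (auto simp: sets_history)
    ultimately show "emeasure N1 A = emeasure N2 A"
      by (simp add: em)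
  qed auto
  then show ?thesis
    using em[OF A] by (simp add: Int_assoc e_def)
qed

text \<open>For fixed \<open>A\<close> both sides are finite measures in \<open>B\<close>, and such
  measures on the line are determined by the half-lines \<open>{u<..}\<close>.\<close>

lemma emeasure_history_hold:
  assumes A: "A \<in> sets (history n)" and B: "B \<in> sets borel"
  shows "emeasure M (A \<inter> move n j j' \<inter> (hold n -` B \<inter> space M)) =
    ennreal (Q $ j $ j') * emeasure M (A \<inter> phase_at n j) * emeasure (exponential_law (lam j)) B"
proof -
  have [measurable]: "A \<in> sets M" using A sets_history_subset by blast
  interpret E: prob_space "exponential_law (lam j)"
    by (rule prob_space_exponential_law)
  let ?e = "ennreal (Q $ j $ j') * emeasure M (A \<inter> phase_at n j)"
  define N1 where "N1 = distr (density M (indicator (A \<inter> move n j j'))) borel (hold n)"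
  define N2 where "N2 = scale_measure ?e (exponential_law (lam j))"
  have em: "emeasure N1 B = emeasure M (A \<inter> move n j j' \<inter> (hold n -` B \<inter> space M))"
    if [measurable]: "B \<in> sets borel" for B
    unfolding N1_def
    by (subst emeasure_distr) (simp_all add: emeasure_density nn_integral_indicator indicator_inter_arith[symmetric] Int_commute del: Int_iff)
  \<comment> \<open>The tail formula covers only nonnegative thresholds; below 0 both measures have
    their full mass to the right.\<close>
  have neg: "emeasure (exponential_law (lam j)) {u<..} = 1" if "u < 0" for u
  proof -
    have "{0<..} \<subseteq> {u<..}" using that by auto
    then have "1 \<le> emeasure (exponential_law (lam j)) {u<..}"
      using emeasure_mono[of "{0<..}" "{u<..}" "exponential_law (lam j)"]
        emeasure_exponential_law_greaterThan[OF lam_pos[of j], of 0] by simp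
    then show ?thesis using E.measure_le_1 by (simp add: antisym)
  qed
  have "N1 = N2"
  proof (rule measure_eqI_lessThan)
    fix u :: real
    have "emeasure N1 {u<..} = emeasure N1 {max 0 u<..}"
    proof -
      have "hold n -` {u<..} \<inter> space M = hold n -` {max 0 u<..} \<inter> space M"
        by (auto simp: hold_pos)
      then show ?thesis by (simp add: em)
    qed
    also have "\<dots> = ?e * ennreal (exp (- lam j * max 0 u))"
      using emeasure_history_tail[OF A, of "max 0 u" j j']
      by (simp add: em vimage_def Int_def conj_commute ennreal_mult' Q_nonneg mult_ac)
    also have "ennreal (exp (- lam j * max 0 u)) = emeasure (exponential_law (lam j)) {u<..}"
      using emeasure_exponential_law_greaterThan[OF lam_pos[of j], of u] neg[of u] by (cases "0 \<le> u") auto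
    finally show "emeasure N1 {u<..} = emeasure N2 {u<..}"
      by (simp add: N2_def)
    show "emeasure N1 {u<..} < \<infinity>"
      by (simp add: em less_top[symmetric])
  qed (auto simp: N1_def N2_def)
  then show ?thesis
    using em[OF B] by (simp add: N2_def)
qed

text \<open>The Markov property: given the history, the \<open>n\<close>-th holding time is exponential and
  independent of the next phase.\<close>

lemma nn_integral_history_step:
  assumes G [measurable]: "G \<in> borel_measurable (history n \<Otimes>\<^sub>M borel)"
  shows "(\<integral>\<^sup>+\<omega>. indicator (move n j j') \<omega> * G (\<omega>, hold n \<omega>) \<partial>M) =
    ennreal (Q $ j $ j') * (\<integral>\<^sup>+\<omega>. indicator (phase_at n j) \<omega> * (\<integral>\<^sup>+s. G (\<omega>, s) \<partial>exponential_law (lam j)) \<partial>M)"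
proof -
  interpret E: prob_space "exponential_law (lam j)"
    by (rule prob_space_exponential_law)
  note [measurable] = ident_history_measurable[of n]
  define N where "N = distr (density M (\<lambda>\<omega>. ennreal (Q $ j $ j') * indicator (phase_at n j) \<omega>)) (history n) (\<lambda>\<omega>. \<omega>)"
  have N_em: "emeasure N A = ennreal (Q $ j $ j') * emeasure M (A \<inter> phase_at n j)"
    if "A \<in> sets (history n)" for A
  proof -
    have [measurable]: "A \<in> sets M" using that sets_history_subset by blast
    have [simp]: "A \<inter> space M = A" using sets.sets_into_space[of A M] by auto
    show ?thesis
      unfolding N_def using that
      by (subst emeasure_distr) (simp_all add: emeasure_density mult.assoc nn_integral_cmult indicator_inter_arith[symmetric] Int_commute del: Int_iff)
  qed
  have N_space: "space N = space M" and N_sets [measurable_cong]: "sets N = sets (history n)"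
    by (simp_all add: N_def)
  interpret N: finite_measure N
  proof
    show "emeasure N (space N) \<noteq> \<infinity>"
      using N_em[of "space M"] sets.top[of "history n"] by (simp add: N_space ennreal_mult_eq_top_iff)
  qed
  \<comment> \<open>On the event \<open>move n j j'\<close>, history and holding time have a product
    law. It suffices to check rectangles, and the claim then follows by Tonelli.\<close>
  have eq: "N \<Otimes>\<^sub>M exponential_law (lam j) =
      distr (density M (indicator (move n j j'))) (history n \<Otimes>\<^sub>M borel) (\<lambda>\<omega>. (\<omega>, hold n \<omega>))" (is "_ = ?R")
  proof (rule pair_measure_eqI)
    show "sigma_finite_measure N" "sigma_finite_measure (exponential_law (lam j))" ..
    show "sets (N \<Otimes>\<^sub>M exponential_law (lam j)) = sets ?R"
      by (simp, intro sets_pair_measure_cong) (auto simp: N_sets)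
    fix A B assume A: "A \<in> sets N" and B: "B \<in> sets (exponential_law (lam j))"
    then have [measurable]: "A \<in> sets M" "A \<in> sets (history n)" "B \<in> sets borel"
      using sets_history_subset by (auto simp: N_sets)
    have "emeasure ?R (A \<times> B) = emeasure M (A \<inter> move n j j' \<inter> (hold n -` B \<inter> space M))"
    proof -
      have "(\<lambda>\<omega>. (\<omega>, hold n \<omega>)) -` (A \<times> B) \<inter> space M = A \<inter> (hold n -` B \<inter> space M)"
        by auto
      then show ?thesis
        by (subst emeasure_distr) (simp_all add: emeasure_density nn_integral_indicator indicator_inter_arith[symmetric] Int_ac del: Int_iff)
    qed
    then show "emeasure N A * emeasure (exponential_law (lam j)) B = emeasure ?R (A \<times> B)"
      using emeasure_history_hold[of A n B j j'] by (simp add: N_em)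
  qed
  have [measurable]: "(\<lambda>\<omega>. \<integral>\<^sup>+s. G (\<omega>, s) \<partial>exponential_law (lam j)) \<in> borel_measurable (history n)"
    by measurable
  note [measurable] = measurable_history_imp[OF this]
  have "(\<integral>\<^sup>+\<omega>. indicator (move n j j') \<omega> * G (\<omega>, hold n \<omega>) \<partial>M) = (\<integral>\<^sup>+z. G z \<partial>?R)"
    by (simp add: nn_integral_distr nn_integral_density)
  also have "\<dots> = (\<integral>\<^sup>+\<omega>. \<integral>\<^sup>+s. G (\<omega>, s) \<partial>exponential_law (lam j) \<partial>N)"
    unfolding eq[symmetric] by (rule E.nn_integral_fst[symmetric]) measurable
  also have "\<dots> = ennreal (Q $ j $ j') *
      (\<integral>\<^sup>+\<omega>. indicator (phase_at n j) \<omega> * (\<integral>\<^sup>+s. G (\<omega>, s) \<partial>exponential_law (lam j)) \<partial>M)"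
    by (simp add: N_def nn_integral_distr nn_integral_density mult.assoc nn_integral_cmult)
  finally show ?thesis .
qed

subsection \<open>First passage along the embedded chain\<close>

text \<open>Between jumps the level increases, so it can enter the region up to \<open>b\<close>
  only at an epoch, and testing the levels after jumps is enough. The test
  \<open>peak k \<omega> \<le> a\<close> allows equality because the peak is not attained in its
  sojourn.\<close>

definition alive :: "real \<Rightarrow> nat \<Rightarrow> 'w \<Rightarrow> bool" where
  "alive a n \<omega> \<longleftrightarrow> (\<forall>k<n. peak k \<omega> \<le> a \<and> b < level (Suc k) \<omega>)"

definition discount :: "real \<Rightarrow> nat \<Rightarrow> 'w \<Rightarrow> ennreal" where
  "discount a n \<omega> = (if alive a n \<omega> then ennreal (exp (- w * T n \<omega>)) else 0)"

text \<open>The second exponential discounts the climb from \<open>level n \<omega>\<close> to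
  \<open>a\<close>, which takes time
  \<open>c (phase n \<omega>) * (a - level n \<omega>)\<close>.\<close>

definition sojourn_gain :: "real \<Rightarrow> ('e \<Rightarrow> ennreal) \<Rightarrow> nat \<Rightarrow> 'w \<Rightarrow> ennreal" where
  "sojourn_gain a g n \<omega> =
     (if a < peak n \<omega>
      then discount a n \<omega> * ennreal (exp (- w * (c (phase n \<omega>) * (a - level n \<omega>)))) * g (phase n \<omega>)
      else 0)"

definition passage_gain :: "real \<Rightarrow> ('e \<Rightarrow> ennreal) \<Rightarrow> 'w \<Rightarrow> ennreal" where
  "passage_gain a g \<omega> =
     (if tau_up X a \<omega> < tau_down X b \<omega>
      then ennreal (exp (- w * real_of_ereal (tau_up X a \<omega>))) * g (J (real_of_ereal (tau_up X a \<omega>)) \<omega>)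
      else 0)"

lemma alive_Suc: "alive a (Suc n) \<omega> \<longleftrightarrow> alive a n \<omega> \<and> peak n \<omega> \<le> a \<and> b < level (Suc n) \<omega>"
  by (auto simp: alive_def less_Suc_eq)

text \<open>After a surviving jump the level exceeds \<open>b \<ge> 0\<close>, so the preceding peak
  was positive. The factor \<open>p < 1\<close> then shrinks it strictly, which puts the level
  strictly below \<open>a\<close>.\<close>

lemma alive_level:
  assumes \<omega>: "\<omega> \<in> space M" and x: "b < x" "x < a" and "alive a n \<omega>"
  shows "b < level n \<omega> \<and> level n \<omega> < a"
proof (cases n)
  case 0
  then show ?thesis using x by (simp add: level_0[OF \<omega>])
next
  case (Suc k)
  then have *: "peak k \<omega> \<le> a" "b < p (phase k \<omega>) * peak k \<omega>"
    using assms by (auto simp: alive_Suc level_Suc)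
  then have "0 < p (phase k \<omega>) * peak k \<omega>"
    using b_nonneg by linarith
  then have "0 < peak k \<omega>"
    using p_pos[of "phase k \<omega>"] by (simp add: zero_less_mult_iff)
  then have "p (phase k \<omega>) * peak k \<omega> < peak k \<omega>"
    using p_less_1[of "phase k \<omega>"] by simp
  then show ?thesis
    using * by (simp add: Suc level_Suc[OF \<omega>])
qed

lemma peak_history: "k < n \<Longrightarrow> peak k \<in> borel_measurable (history n)"
proof -
  assume "k < n"
  then have [measurable]: "phase k \<in> measurable (history n) (count_space UNIV)"
    "hold k \<in> borel_measurable (history n)" "level k \<in> borel_measurable (history n)"
    by (auto intro: phase_history hold_history level_history)
  show ?thesis unfolding peak_def[abs_def] by measurable
qed

lemma peak_measurable [measurable]: "peak n \<in> borel_measurable M"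
  and level_measurable [measurable]: "level n \<in> borel_measurable M"
  and T_measurable' [measurable]: "T n \<in> borel_measurable M"
  using peak_history[of n "Suc n"] level_history[of n n] T_history[of n n] measurable_history_imp by auto

lemma discount_history: "discount a n \<in> borel_measurable (history n)"
proof -
  have alive: "Measurable.pred (history n) (alive a k)" if "k \<le> n" for k
    using that
  proof (induction k)
    case 0
    then show ?case by (simp add: alive_def[abs_def])
  next
    case (Suc k)
    then have [measurable]: "peak k \<in> borel_measurable (history n)" "Measurable.pred (history n) (alive a k)"
      "level (Suc k) \<in> borel_measurable (history n)"
      by (auto intro: peak_history level_history)
    show ?case unfolding alive_Suc[abs_def] by measurable
  qed
  note [measurable] = alive[OF order_refl] T_history[OF order_refl]
  show ?thesis unfolding discount_def[abs_def] by measurable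
qed

lemma discount_measurable [measurable]: "discount a n \<in> borel_measurable M"
  by (rule measurable_history_imp[OF discount_history])

lemma sojourn_gain_measurable [measurable]: "sojourn_gain a g n \<in> borel_measurable M"
  unfolding sojourn_gain_def[abs_def] by measurable

text \<open>One step of the martingale. Pathwise, gain plus next discounted value is the current
  discount times \<open>step_gain\<close> at the actual holding time and next phase. Integrating
  these out by \<open>nn_integral_history_step\<close> produces \<open>step_op\<close>, and the
  renewal equation turns it into \<open>h\<close>.\<close>

lemma nn_integral_telescope:
  assumes x: "b < x" "x < a" and sol: "renewal_solution a g h"
  shows "(\<integral>\<^sup>+\<omega>. sojourn_gain a g n \<omega> \<partial>M) +
      (\<integral>\<^sup>+\<omega>. discount a (Suc n) \<omega> * h (phase (Suc n) \<omega>) (level (Suc n) \<omega>) \<partial>M) =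
    (\<integral>\<^sup>+\<omega>. discount a n \<omega> * h (phase n \<omega>) (level n \<omega>) \<partial>M)"
proof -
  have h_meas [measurable]: "h k \<in> borel_measurable borel"
    and h_zero: "y \<le> b \<Longrightarrow> h k y = 0" and h_step: "b < y \<Longrightarrow> y \<le> a \<Longrightarrow> step_op a g h k y = h k y" for k y
    using sol by (auto simp: renewal_solution_def)
  let ?G = "\<lambda>j j' (\<omega>, s). discount a n \<omega> * step_gain a g h j j' (level n \<omega>) s"
  note [measurable] = discount_history level_history[OF order_refl]
  have G [measurable]: "?G j j' \<in> borel_measurable (history n \<Otimes>\<^sub>M borel)" for j j'
    by measurable
  have G_M [measurable]: "(\<lambda>\<omega>. ?G j j' (\<omega>, hold n \<omega>)) \<in> borel_measurable M" for j j'
    by (simp, measurable)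
  have inner_hist: "(\<lambda>\<omega>. \<integral>\<^sup>+s. ?G j j' (\<omega>, s) \<partial>exponential_law (lam j)) \<in> borel_measurable (history n)" for j j'
  proof -
    interpret E: prob_space "exponential_law (lam j)"
      by (rule prob_space_exponential_law)
    show ?thesis by measurable
  qed
  note [measurable] = measurable_history_imp[OF inner_hist]
  have pointwise: "sojourn_gain a g n \<omega> + discount a (Suc n) \<omega> * h (phase (Suc n) \<omega>) (level (Suc n) \<omega>) =
      (\<Sum>j\<in>UNIV. \<Sum>j'\<in>UNIV. indicator (move n j j') \<omega> * ?G j j' (\<omega>, hold n \<omega>))" if \<omega>: "\<omega> \<in> space M" for \<omega>
  proof -
    have ind: "indicator (move n j j') \<omega> = (if j = phase n \<omega> then if j' = phase (Suc n) \<omega> then 1 else 0 else 0 :: ennreal)"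
      for j j'
      using \<omega> by (auto simp: move_def)
    have 1: "(\<Sum>j\<in>UNIV. \<Sum>j'\<in>UNIV. indicator (move n j j') \<omega> * ?G j j' (\<omega>, hold n \<omega>)) =
        discount a n \<omega> * step_gain a g h (phase n \<omega>) (phase (Suc n) \<omega>) (level n \<omega>) (hold n \<omega>)"
      by (simp add: ind if_distrib[of "\<lambda>u. u * _"] sum.If_cases cong: if_cong)
    have 2: "discount a (Suc n) \<omega> = discount a n \<omega> * ennreal (exp (- w * hold n \<omega>))"
      if "peak n \<omega> \<le> a" "b < level (Suc n) \<omega>"
      using that by (simp add: discount_def alive_Suc T_Suc distrib_left exp_add exp_diff exp_minus ennreal_mult'[symmetric] field_simps)
    show ?thesis
    proof (cases "a < peak n \<omega>")
      case True
      then show ?thesis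
        unfolding 1 by (simp add: sojourn_gain_def discount_def alive_Suc step_gain_def peak_def[symmetric] mult.assoc)
    next
      case False
      then have "sojourn_gain a g n \<omega> = 0"
        by (simp add: sojourn_gain_def)
      \<comment> \<open>If the jump lands at or below \<open>b\<close>, the left side is killed and
        the right side vanishes because \<open>h\<close> is 0 there.\<close>
      moreover have "discount a (Suc n) \<omega> * h (phase (Suc n) \<omega>) (level (Suc n) \<omega>) =
          discount a n \<omega> * (ennreal (exp (- w * hold n \<omega>)) * h (phase (Suc n) \<omega>) (level (Suc n) \<omega>))"
        using False 2 h_zero[of "level (Suc n) \<omega>"]
        by (cases "b < level (Suc n) \<omega>") (auto simp: mult.assoc)
      ultimately show ?thesis
        unfolding 1 using False by (simp add: step_gain_def peak_def[symmetric] level_Suc[OF \<omega>])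
    qed
  qed
  have "(\<integral>\<^sup>+\<omega>. sojourn_gain a g n \<omega> \<partial>M) +
      (\<integral>\<^sup>+\<omega>. discount a (Suc n) \<omega> * h (phase (Suc n) \<omega>) (level (Suc n) \<omega>) \<partial>M) =
    (\<integral>\<^sup>+\<omega>. sojourn_gain a g n \<omega> + discount a (Suc n) \<omega> * h (phase (Suc n) \<omega>) (level (Suc n) \<omega>) \<partial>M)"
    by (rule nn_integral_add[symmetric]) measurable
  also have "\<dots> = (\<integral>\<^sup>+\<omega>. (\<Sum>j\<in>UNIV. \<Sum>j'\<in>UNIV. indicator (move n j j') \<omega> * ?G j j' (\<omega>, hold n \<omega>)) \<partial>M)"
    by (rule nn_integral_cong) (rule pointwise)
  also have "\<dots> = (\<Sum>j\<in>UNIV. \<Sum>j'\<in>UNIV. \<integral>\<^sup>+\<omega>. indicator (move n j j') \<omega> * ?G j j' (\<omega>, hold n \<omega>) \<partial>M)"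
    by (subst nn_integral_sum; (intro sum.cong nn_integral_sum refl)?; measurable)
  also have "\<dots> = (\<Sum>j\<in>UNIV. \<Sum>j'\<in>UNIV. ennreal (Q $ j $ j') *
      (\<integral>\<^sup>+\<omega>. indicator (phase_at n j) \<omega> * (\<integral>\<^sup>+s. ?G j j' (\<omega>, s) \<partial>exponential_law (lam j)) \<partial>M))"
    by (intro sum.cong refl nn_integral_history_step G)
  also have "\<dots> = (\<integral>\<^sup>+\<omega>. (\<Sum>j\<in>UNIV. \<Sum>j'\<in>UNIV. ennreal (Q $ j $ j') *
      (indicator (phase_at n j) \<omega> * (\<integral>\<^sup>+s. ?G j j' (\<omega>, s) \<partial>exponential_law (lam j)))) \<partial>M)"
    by (subst nn_integral_sum; (intro sum.cong refl)?; (subst nn_integral_sum; (intro sum.cong refl nn_integral_cmult[symmetric])?)?; measurable)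
  also have "\<dots> = (\<integral>\<^sup>+\<omega>. discount a n \<omega> * h (phase n \<omega>) (level n \<omega>) \<partial>M)"
  proof (rule nn_integral_cong)
    fix \<omega> assume \<omega>: "\<omega> \<in> space M"
    have ind: "indicator (phase_at n j) \<omega> = (if j = phase n \<omega> then 1 else 0 :: ennreal)" for j
      using \<omega> by (auto simp: phase_at_def)
    have "(\<Sum>j\<in>UNIV. \<Sum>j'\<in>UNIV. ennreal (Q $ j $ j') *
        (indicator (phase_at n j) \<omega> * (\<integral>\<^sup>+s. ?G j j' (\<omega>, s) \<partial>exponential_law (lam j)))) =
      (\<Sum>j\<in>UNIV. indicator (phase_at n j) \<omega> * (discount a n \<omega> * step_op a g h j (level n \<omega>)))"
      by (simp add: step_op_def nn_integral_cmult sum_distrib_left mult_ac)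
    also have "\<dots> = discount a n \<omega> * step_op a g h (phase n \<omega>) (level n \<omega>)"
      by (simp add: ind if_distrib[of "\<lambda>u. u * _"] sum.If_cases cong: if_cong)
    \<comment> \<open>Where the discount is nonzero the path is alive, so the level lies in the
      range of the renewal equation.\<close>
    also have "\<dots> = discount a n \<omega> * h (phase n \<omega>) (level n \<omega>)"
      using alive_level[OF \<omega> x, of n] h_step[of "level n \<omega>"] by (auto simp: discount_def)
    finally show "(\<Sum>j\<in>UNIV. \<Sum>j'\<in>UNIV. ennreal (Q $ j $ j') *
        (indicator (phase_at n j) \<omega> * (\<integral>\<^sup>+s. ?G j j' (\<omega>, s) \<partial>exponential_law (lam j)))) =
      discount a n \<omega> * h (phase n \<omega>) (level n \<omega>)" .
  qed
  finally show ?thesis .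
qed

text \<open>Summing the one-step identities leaves a remainder at most the expectation of
  \<open>exp (- w * T n \<omega>)\<close>, as \<open>h \<le> 1\<close>. It tends to 0 by dominated
  convergence, since \<open>w > 0\<close> and the epochs tend to infinity.\<close>

lemma nn_integral_sojourn_gains:
  assumes x: "b < x" "x < a" and sol: "renewal_solution a g h"
  shows "(\<integral>\<^sup>+\<omega>. (\<Sum>n. sojourn_gain a g n \<omega>) \<partial>M) = h i x"
proof -
  have [measurable]: "h k \<in> borel_measurable borel" and h_le_1: "h k y \<le> 1" for k y
    using sol by (auto simp: renewal_solution_def)
  let ?C = "\<lambda>n. \<integral>\<^sup>+\<omega>. sojourn_gain a g n \<omega> \<partial>M"
  let ?R = "\<lambda>n. \<integral>\<^sup>+\<omega>. discount a n \<omega> * h (phase n \<omega>) (level n \<omega>) \<partial>M"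
  have start: "?R 0 = h i x"
  proof -
    have "?R 0 = (\<integral>\<^sup>+\<omega>. h i x \<partial>M)"
      by (rule nn_integral_cong) (simp add: discount_def alive_def T_0 phase_0 level_0)
    then show ?thesis by (simp add: emeasure_space_1)
  qed
  have partial: "(\<Sum>k<n. ?C k) + ?R n = h i x" for n
  proof (induction n)
    case 0
    then show ?case by (simp only: start lessThan_0 sum.empty add_0)
  next
    case (Suc n)
    then show ?case
      using nn_integral_telescope[OF x sol, of n] by (simp add: add.assoc)
  qed
  have "(\<lambda>n. \<integral>\<^sup>+\<omega>. ennreal (exp (- w * T n \<omega>)) \<partial>M) \<longlonglongrightarrow> (\<integral>\<^sup>+\<omega>. 0 \<partial>M)"
  proof (rule nn_integral_dominated_convergence[where w = "\<lambda>_. 1"])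
    show "AE \<omega> in M. ennreal (exp (- w * T n \<omega>)) \<le> 1" for n
    proof (rule AE_I2)
      fix \<omega> assume \<omega>: "\<omega> \<in> space M"
      then have "0 \<le> T n \<omega>"
        using T_strict_mono[OF \<omega>] T_0[OF \<omega>] by (metis le0 strict_mono_less_eq)
      then show "ennreal (exp (- w * T n \<omega>)) \<le> 1"
        using w_pos by (simp add: ennreal_le_1)
    qed
    show "AE \<omega> in M. (\<lambda>n. ennreal (exp (- w * T n \<omega>))) \<longlonglongrightarrow> 0"
    proof (rule AE_I2)
      fix \<omega> assume \<omega>: "\<omega> \<in> space M"
      have "filterlim (\<lambda>n. w * T n \<omega>) at_top sequentially"
        using T_at_top[OF \<omega>] w_pos by (rule filterlim_tendsto_pos_mult_at_top[OF tendsto_const, rotated])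
      then have "(\<lambda>n. exp (- (w * T n \<omega>))) \<longlonglongrightarrow> 0"
        by (intro filterlim_compose[OF exp_at_bot]) (simp add: filterlim_uminus_at_bot)
      then show "(\<lambda>n. ennreal (exp (- w * T n \<omega>))) \<longlonglongrightarrow> 0"
        using tendsto_ennrealI by fastforce
    qed
  qed (auto simp: emeasure_space_1)
  then have lim: "(\<lambda>n. \<integral>\<^sup>+\<omega>. ennreal (exp (- w * T n \<omega>)) \<partial>M) \<longlonglongrightarrow> 0"
    by simp
  have "?R n \<le> (\<integral>\<^sup>+\<omega>. ennreal (exp (- w * T n \<omega>)) \<partial>M)" for n
    using h_le_1 mult_left_mono[OF h_le_1] by (intro nn_integral_mono) (fastforce simp: discount_def)
  then have "?R \<longlonglongrightarrow> 0"
    by (intro tendsto_sandwich[OF _ _ tendsto_const lim]) auto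
  then have "(\<lambda>n. (\<Sum>k<n. ?C k) + ?R n) \<longlonglongrightarrow> (\<Sum>n. ?C n) + 0"
    by (intro tendsto_add summable_LIMSEQ) auto
  then have "(\<Sum>n. ?C n) = h i x"
    unfolding partial by (simp add: LIMSEQ_const_iff)
  then show ?thesis
    by (subst nn_integral_suminf) auto
qed

section \<open>Pathwise identification of the passage times\<close>

lemma epoch_containing:
  assumes \<omega>: "\<omega> \<in> space M" and "0 \<le> t"
  obtains n where "T n \<omega> \<le> t" "t < T (Suc n) \<omega>"
proof -
  obtain N where "t < T N \<omega>"
    using filterlim_at_top_dense[THEN iffD1, OF T_at_top[OF \<omega>], rule_format, of t]
    by (auto simp: eventually_sequentially)
  define m where "m = (LEAST N. t < T N \<omega>)"
  have m: "t < T m \<omega>"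
    unfolding m_def by (rule LeastI) fact
  then obtain n where n: "m = Suc n"
    using T_0[OF \<omega>] \<open>0 \<le> t\<close> by (cases m) auto
  have "\<not> t < T n \<omega>"
    using not_less_Least[of n "\<lambda>N. t < T N \<omega>"] n by (simp add: m_def)
  then show ?thesis
    using m n by (intro that[of n]) auto
qed

lemma X_in_sojourn:
  assumes "\<omega> \<in> space M" "T n \<omega> \<le> t" "t < T (Suc n) \<omega>"
  shows "X t \<omega> = level n \<omega> + (t - T n \<omega>) / c (phase n \<omega>)"
    and "level n \<omega> \<le> X t \<omega>" and "X t \<omega> < peak n \<omega>"
  using X_between[OF assms] assms c_pos[of "phase n \<omega>"]
  by (auto simp: level_def phase_def peak_def hold_def divide_strict_right_mono)

lemma T_mono: "\<omega> \<in> space M \<Longrightarrow> m \<le> n \<Longrightarrow> T m \<omega> \<le> T n \<omega>"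
  using T_strict_mono strict_mono_less_eq by blast

lemma tau_up_ge:
  assumes \<omega>: "\<omega> \<in> space M" and "\<And>k. k < n \<Longrightarrow> peak k \<omega> \<le> a"
  shows "ereal (T n \<omega>) \<le> tau_up X a \<omega>"
  unfolding tau_up_def
proof (rule INF_greatest)
  fix t assume t: "t \<in> {t. 0 \<le> t \<and> a \<le> X t \<omega>}"
  then obtain m where m: "T m \<omega> \<le> t" "t < T (Suc m) \<omega>"
    using epoch_containing[OF \<omega>, of t] by auto
  have "\<not> m < n"
    using X_in_sojourn(3)[OF \<omega> m] assms(2)[of m] t by auto
  then show "ereal (T n \<omega>) \<le> ereal t"
    using T_mono[OF \<omega>, of n m] m by simp
qed

text \<open>Within a sojourn the level never falls below its starting value, so a visit to the
  region up to \<open>b\<close> needs a sojourn that starts there.\<close>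

lemma tau_down_ge:
  assumes \<omega>: "\<omega> \<in> space M" and "\<And>k. k < n \<Longrightarrow> b < level k \<omega>"
  shows "ereal (T n \<omega>) \<le> tau_down X b \<omega>"
  unfolding tau_down_def
proof (rule INF_greatest)
  fix t assume t: "t \<in> {t. 0 \<le> t \<and> X t \<omega> \<le> b}"
  then obtain m where m: "T m \<omega> \<le> t" "t < T (Suc m) \<omega>"
    using epoch_containing[OF \<omega>, of t] by auto
  have "\<not> m < n"
    using X_in_sojourn(2)[OF \<omega> m] assms(2)[of m] t by auto
  then show "ereal (T n \<omega>) \<le> ereal t"
    using T_mono[OF \<omega>, of n m] m by simp
qed

text \<open>\<open>\<sigma>\<close> is the time at which the rising line of sojourn \<open>n\<close>
  meets \<open>a\<close>; the strict inequality for the peak places it before the next epoch. All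
  levels up to sojourn \<open>n\<close> exceed \<open>b\<close>, so the downward passage comes no
  earlier than that epoch.\<close>

lemma passage_during_sojourn:
  assumes \<omega>: "\<omega> \<in> space M" and x: "b < x" "x < a" and alive: "alive a n \<omega>" and peak: "a < peak n \<omega>"
  defines "\<sigma> \<equiv> T n \<omega> + c (phase n \<omega>) * (a - level n \<omega>)"
  shows "tau_up X a \<omega> = ereal \<sigma>" and "ereal \<sigma> < tau_down X b \<omega>" and "J \<sigma> \<omega> = phase n \<omega>"
proof -
  have level: "b < level k \<omega>" "level k \<omega> < a" if "k \<le> n" for k
    using alive_level[OF \<omega> x, of k] alive that by (auto simp: alive_def)
  have c: "0 < c (phase n \<omega>)" by (rule c_pos)
  have \<sigma>: "T n \<omega> \<le> \<sigma>" "\<sigma> < T (Suc n) \<omega>"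
    using level[of n] peak c by (auto simp: \<sigma>_def T_Suc peak_def field_simps)
  show "J \<sigma> \<omega> = phase n \<omega>"
    using J_between[OF \<omega> \<sigma>] by (simp add: phase_def)
  have "X \<sigma> \<omega> = a"
    using X_in_sojourn(1)[OF \<omega> \<sigma>] c by (simp add: \<sigma>_def)
  moreover have "0 \<le> \<sigma>"
    using \<sigma> T_mono[OF \<omega>, of 0 n] T_0[OF \<omega>] by simp
  ultimately have "tau_up X a \<omega> \<le> ereal \<sigma>"
    unfolding tau_up_def by (intro INF_lower) simp
  moreover have "ereal \<sigma> \<le> tau_up X a \<omega>"
    unfolding tau_up_def
  proof (rule INF_greatest)
    fix t assume t: "t \<in> {t. 0 \<le> t \<and> a \<le> X t \<omega>}"
    then obtain m where m: "T m \<omega> \<le> t" "t < T (Suc m) \<omega>"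
      using epoch_containing[OF \<omega>, of t] by auto
    \<comment> \<open>Earlier sojourns stay below peaks that are at most \<open>a\<close>, sojourn
      \<open>n\<close> is an explicit line, and later sojourns start after
      \<open>\<sigma>\<close>.\<close>
    consider "m < n" | "m = n" | "n < m" by linarith
    then show "ereal \<sigma> \<le> ereal t"
    proof cases
      case 1
      then show ?thesis
        using X_in_sojourn(3)[OF \<omega> m] alive t by (auto simp: alive_def)
    next
      case 2
      then have "a \<le> level n \<omega> + (t - T n \<omega>) / c (phase n \<omega>)"
        using X_in_sojourn(1)[OF \<omega> m] t by simp
      then show ?thesis
        using c by (simp add: \<sigma>_def field_simps)
    next
      case 3
      then show ?thesis
        using T_mono[OF \<omega>, of "Suc n" m] \<sigma> m by simp
    qed
  qed
  ultimately show "tau_up X a \<omega> = ereal \<sigma>"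
    by (rule antisym)
  have "ereal (T (Suc n) \<omega>) \<le> tau_down X b \<omega>"
    using level by (intro tau_down_ge[OF \<omega>]) auto
  then show "ereal \<sigma> < tau_down X b \<omega>"
    using \<sigma> by (meson ereal_less_le less_ereal.simps(1) order_less_le_trans)
qed

text \<open>A path that survives forever has an upward passage time beyond every epoch, hence
  infinite. Otherwise the first failure cannot come from a peak, so the level drops to
  \<open>b\<close> or below at epoch \<open>m\<close>, no later than any passage above
  \<open>a\<close>.\<close>

lemma no_passage:
  assumes \<omega>: "\<omega> \<in> space M" and "\<And>n. alive a n \<omega> \<Longrightarrow> peak n \<omega> \<le> a"
  shows "\<not> tau_up X a \<omega> < tau_down X b \<omega>"
proof (cases "\<forall>n. alive a n \<omega>")
  case True
  then have "ereal (T n \<omega>) \<le> tau_up X a \<omega>" for n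
    using assms by (intro tau_up_ge) auto
  moreover have "\<exists>n. B < ereal (T n \<omega>)" if "B < \<infinity>" for B
  proof -
    obtain r where "B \<le> ereal r"
      using \<open>B < \<infinity>\<close> by (cases B) auto
    moreover obtain N where "r < T N \<omega>"
      using filterlim_at_top_dense[THEN iffD1, OF T_at_top[OF \<omega>], rule_format, of r]
      by (auto simp: eventually_sequentially)
    ultimately show ?thesis
      by (meson ereal_less_eq(3) le_less_trans less_ereal.simps(1))
  qed
  ultimately have "tau_up X a \<omega> = \<infinity>"
    by (meson ereal_infty_less(1) linorder_not_less)
  then show ?thesis by simp
next
  case False
  define m where "m = (LEAST n. \<not> alive a n \<omega>)"
  have m: "\<not> alive a m \<omega>"
    unfolding m_def using False by (metis (mono_tags, lifting) LeastI)
  then obtain n where n: "m = Suc n"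
    by (cases m) (auto simp: alive_def)
  have "alive a n \<omega>"
    using not_less_Least[of n "\<lambda>n. \<not> alive a n \<omega>"] n by (simp add: m_def)
  then have "peak n \<omega> \<le> a" and below: "\<And>k. k < n \<Longrightarrow> peak k \<omega> \<le> a"
    using assms(2)[of n] by (simp_all add: alive_def)
  then have "level m \<omega> \<le> b"
    using m \<open>alive a n \<omega>\<close> by (simp add: n alive_Suc)
  have "ereal (T m \<omega>) \<le> tau_up X a \<omega>"
    using below \<open>peak n \<omega> \<le> a\<close> unfolding n by (intro tau_up_ge[OF \<omega>]) (auto simp: less_Suc_eq)
  moreover have "tau_down X b \<omega> \<le> ereal (T m \<omega>)"
    unfolding tau_down_def using \<open>level m \<omega> \<le> b\<close> T_mono[OF \<omega>, of 0 m] T_0[OF \<omega>]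
    by (intro INF_lower) (simp add: level_def)
  ultimately show ?thesis by simp
qed

text \<open>At most one term is nonzero: sojourns before the passage have peaks at most
  \<open>a\<close>, and after it the path is no longer alive.\<close>

lemma passage_gain_eq_suminf:
  assumes \<omega>: "\<omega> \<in> space M" and x: "b < x" "x < a"
  shows "passage_gain a g \<omega> = (\<Sum>n. sojourn_gain a g n \<omega>)"
proof (cases "\<exists>n. alive a n \<omega> \<and> a < peak n \<omega>")
  case True
  then obtain n where n: "alive a n \<omega>" "a < peak n \<omega>" by blast
  have "sojourn_gain a g k \<omega> = 0" if "k \<noteq> n" for k
  proof (cases "k < n")
    case True
    then have "peak k \<omega> \<le> a" using n(1) by (simp add: alive_def)
    then show ?thesis by (simp add: sojourn_gain_def)
  next
    case False
    then have "\<not> alive a k \<omega>" using n(2) that by (auto simp: alive_def not_le intro!: exI[of _ n])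
    then show ?thesis by (simp add: sojourn_gain_def discount_def)
  qed
  then have "(\<Sum>n. sojourn_gain a g n \<omega>) = sojourn_gain a g n \<omega>"
    by (subst suminf_finite[of "{n}"]) auto
  also have "\<dots> = passage_gain a g \<omega>"
    using passage_during_sojourn[OF \<omega> x n] n
    by (simp add: sojourn_gain_def discount_def passage_gain_def ennreal_mult'[symmetric] exp_add[symmetric] distrib_left)
  finally show ?thesis by simp
next
  case False
  then have "sojourn_gain a g n \<omega> = 0" for n
    by (simp add: sojourn_gain_def discount_def)
  then show ?thesis
    using no_passage[OF \<omega>, of a] False by (auto simp: passage_gain_def not_less)
qed

text \<open>The passage times are infima over uncountable sets of times; measurability comes from
  the series over sojourns.\<close>

lemma passage_gain_measurable:
  assumes "b < x" "x < a"
  shows "passage_gain a g \<in> borel_measurable M"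
  using measurable_cong[of M "passage_gain a g" "\<lambda>\<omega>. \<Sum>n. sojourn_gain a g n \<omega>" borel]
    passage_gain_eq_suminf assms by simp

lemma nn_integral_passage_gain:
  assumes "b < x" "x < a" "renewal_solution a g h"
  shows "(\<integral>\<^sup>+\<omega>. passage_gain a g \<omega> \<partial>M) = h i x"
  using nn_integral_sojourn_gains[OF assms] assms
  by (simp add: passage_gain_eq_suminf cong: nn_integral_cong)

text \<open>The passage gain is linear in the terminal vector, so expanding \<open>g\<close> in
  indicators and integrating gives the expansion of \<open>h\<close>.\<close>

lemma renewal_solution_decomposition:
  assumes x: "b < x" "x < a" and "renewal_solution a g h"
    and "\<And>k. renewal_solution a (indicator {k}) (H k)"
  shows "h i x = (\<Sum>k\<in>UNIV. H k i x * g k)"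
proof -
  note [measurable] = passage_gain_measurable[OF x]
  have "passage_gain a g \<omega> = (\<Sum>k\<in>UNIV. passage_gain a (indicator {k}) \<omega> * g k)" for \<omega>
  proof -
    have "(\<Sum>k\<in>UNIV. u * indicator {k} j * g k) = u * g j" for u :: ennreal and j
    proof -
      have "u * indicator {k} j * g k = (if k = j then u * g k else 0)" for k
        by (auto simp: indicator_def)
      then show ?thesis by simp
    qed
    then show ?thesis by (simp add: passage_gain_def)
  qed
  then have "h i x = (\<integral>\<^sup>+\<omega>. (\<Sum>k\<in>UNIV. passage_gain a (indicator {k}) \<omega> * g k) \<partial>M)"
    using nn_integral_passage_gain[OF assms(1-3)] by simp
  also have "\<dots> = (\<Sum>k\<in>UNIV. H k i x * g k)"
    using nn_integral_passage_gain[OF x assms(4)] by (simp add: nn_integral_sum nn_integral_multc)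
  finally show ?thesis .
qed

lemma expectation_passage:
  assumes x: "b < x" "x < a" and "renewal_solution a (indicator {j}) h"
  shows "expectation (\<lambda>\<omega>. if tau_up X a \<omega> < tau_down X b \<omega> \<and> J (real_of_ereal (tau_up X a \<omega>)) \<omega> = j
      then exp (- w * real_of_ereal (tau_up X a \<omega>)) else 0) = enn2real (h i x)" (is "expectation ?f = _")
proof -
  have f: "?f = (\<lambda>\<omega>. enn2real (passage_gain a (indicator {j}) \<omega>))"
    by (auto simp: passage_gain_def)
  have "?f \<in> borel_measurable M"
    unfolding f using passage_gain_measurable[OF x, of "indicator {j}"] by measurable
  then have "expectation ?f = enn2real (\<integral>\<^sup>+\<omega>. ennreal (?f \<omega>) \<partial>M)"
    by (rule integral_eq_nn_integral) auto
  also have "(\<integral>\<^sup>+\<omega>. ennreal (?f \<omega>) \<partial>M) = (\<integral>\<^sup>+\<omega>. passage_gain a (indicator {j}) \<omega> \<partial>M)"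
    by (rule nn_integral_cong) (auto simp: passage_gain_def)
  finally show ?thesis
    using nn_integral_passage_gain[OF assms] by simp
qed

end

subsection \<open>Passage matrices\<close>

text \<open>For a nonzero kernel vector, the row of an entry of largest modulus would contradict
  dominance.\<close>

lemma invertible_diagonally_dominant:
  fixes A :: "real ^ 'n ^ 'n"
  assumes dominant: "\<And>i. (\<Sum>j\<in>UNIV - {i}. \<bar>A $ i $ j\<bar>) < \<bar>A $ i $ i\<bar>"
  shows "invertible A"
proof -
  have "v = 0" if "A *v v = 0" for v
  proof (rule ccontr)
    assume "v \<noteq> 0"
    obtain i where i: "\<And>j. \<bar>v $ j\<bar> \<le> \<bar>v $ i\<bar>"
    proof -
      have "Max (range (\<lambda>j. \<bar>v $ j\<bar>)) \<in> range (\<lambda>j. \<bar>v $ j\<bar>)"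
        by (rule Max_in) auto
      then obtain i where "Max (range (\<lambda>j. \<bar>v $ j\<bar>)) = \<bar>v $ i\<bar>"
        by blast
      then have "\<bar>v $ j\<bar> \<le> \<bar>v $ i\<bar>" for j
        by (metis Max_ge finite finite_imageI rangeI)
      then show ?thesis by (rule that)
    qed
    have "0 < \<bar>v $ i\<bar>"
      using \<open>v \<noteq> 0\<close> i by (metis abs_0 abs_not_less_zero less_le not_less vec_eq_iff zero_index zero_less_abs_iff)
    have "0 = (\<Sum>j\<in>UNIV. A $ i $ j * v $ j)"
      using arg_cong[OF that, of "\<lambda>u. u $ i"] by (simp add: matrix_vector_mult_def)
    also have "\<dots> = A $ i $ i * v $ i + (\<Sum>j\<in>UNIV - {i}. A $ i $ j * v $ j)"
      by (simp add: sum.remove)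
    finally have "\<bar>A $ i $ i\<bar> * \<bar>v $ i\<bar> = \<bar>\<Sum>j\<in>UNIV - {i}. A $ i $ j * v $ j\<bar>"
      by (simp add: abs_mult[symmetric] eq_neg_iff_add_eq_0[symmetric])
    also have "\<dots> \<le> (\<Sum>j\<in>UNIV - {i}. \<bar>A $ i $ j\<bar> * \<bar>v $ i\<bar>)"
      by (rule order_trans[OF sum_abs]) (auto simp: abs_mult intro!: sum_mono mult_left_mono i)
    also have "\<dots> < \<bar>A $ i $ i\<bar> * \<bar>v $ i\<bar>"
      unfolding sum_distrib_right[symmetric] using dominant[of i] \<open>0 < \<bar>v $ i\<bar>\<close> by simp
    finally show False by simp
  qed
  then show ?thesis
    by (simp add: invertible_left_inverse matrix_left_invertible_ker)
qed

text \<open>All initial states are needed together, since different rows and starting levels of the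
  passage matrix belong to different laws.\<close>

locale level_phase_family = level_phase_model c lam p Q w b
  for c lam p :: "'e::finite \<Rightarrow> real" and Q :: "real ^ 'e ^ 'e" and w b :: real +
  fixes P :: "real \<Rightarrow> 'e \<Rightarrow> 'w measure" and X :: "real \<Rightarrow> 'w \<Rightarrow> real" and J :: "real \<Rightarrow> 'w \<Rightarrow> 'e"
  assumes process: "0 \<le> x \<Longrightarrow> level_phase_process c lam p Q (P x i) X J x i"
begin

lemma epochs_exist:
  assumes "0 \<le> x"
  obtains T where "level_phase_epochs c lam p Q w b (P x i) X J x i T"
proof -
  from process[OF assms, of i] show ?thesis
    unfolding level_phase_process_def
  proof (elim conjE exE)
    fix T
    assume *: "prob_space (P x i)"
      "\<forall>n. T n \<in> borel_measurable (P x i)"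
      "\<forall>n. (\<lambda>\<omega>. J (T n \<omega>) \<omega>) \<in> measurable (P x i) (count_space UNIV)"
      "\<forall>\<omega>\<in>space (P x i).
         T 0 \<omega> = 0 \<and> strict_mono (\<lambda>n. T n \<omega>) \<and> filterlim (\<lambda>n. T n \<omega>) at_top sequentially \<and>
         X 0 \<omega> = x \<and> J 0 \<omega> = i \<and>
         (\<forall>n. \<forall>t\<in>{T n \<omega>..<T (Suc n) \<omega>}.
            J t \<omega> = J (T n \<omega>) \<omega> \<and>
            X t \<omega> = X (T n \<omega>) \<omega> + (t - T n \<omega>) / c (J (T n \<omega>) \<omega>)) \<and>
         (\<forall>n. X (T (Suc n) \<omega>) \<omega> =
            p (J (T n \<omega>) \<omega>) * (X (T n \<omega>) \<omega> + (T (Suc n) \<omega> - T n \<omega>) / c (J (T n \<omega>) \<omega>)))"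
      "\<forall>n (j :: nat \<Rightarrow> 'e) (t :: nat \<Rightarrow> real). j 0 = i \<and> (\<forall>k<n. 0 \<le> t k) \<longrightarrow>
         measure (P x i) {\<omega> \<in> space (P x i). (\<forall>k\<le>n. J (T k \<omega>) \<omega> = j k) \<and>
                                 (\<forall>k<n. t k < T (Suc k) \<omega> - T k \<omega>)} =
         (\<Prod>k<n. exp (- lam (j k) * t k) * Q $ j k $ j (Suc k))"
    interpret prob_space "P x i" by fact
    have "level_phase_epochs c lam p Q w b (P x i) X J x i T"
    proof unfold_locales
      show "prob {\<omega> \<in> space (P x i). (\<forall>k\<le>n. J (T k \<omega>) \<omega> = j k) \<and> (\<forall>k<n. t k < T (Suc k) \<omega> - T k \<omega>)} =
        (\<Prod>k<n. exp (- lam (j k) * t k) * Q $ j k $ j (Suc k))"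
        if "j 0 = i" "\<And>k. k < n \<Longrightarrow> 0 \<le> t k" for j n t
        using *(5) that by blast
    qed (use *(2-4) in auto)
    then show ?thesis by (rule that)
  qed
qed

abbreviation Z :: "real \<Rightarrow> real \<Rightarrow> real ^ 'e ^ 'e" where
  "Z \<equiv> Z_up P X J w b"

lemma renewal_solution_indicator_exists: "\<exists>h. renewal_solution a (indicator {j}) h"
  by (rule renewal_solution_exists) (simp add: indicator_def)

lemma Z_entry:
  assumes "b < x" "x < a" and h: "renewal_solution a (indicator {j}) h"
  shows "ennreal (Z x a $ i $ j) = h i x"
proof -
  obtain T where "level_phase_epochs c lam p Q w b (P x i) X J x i T"
    using epochs_exist[of x i] assms b_nonneg by auto
  then interpret level_phase_epochs c lam p Q w b "P x i" X J x i T .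
  have "Z x a $ i $ j = enn2real (h i x)"
    using assms expectation_passage[OF assms] by (simp add: Z_up_def)
  moreover have "h i x < top"
    using h order_le_less_trans[of "h i x" 1 top] by (simp add: renewal_solution_def)
  ultimately show ?thesis by simp
qed

lemma Z_nonneg:
  assumes "b < x" "x < a"
  shows "0 \<le> Z x a $ i $ j"
  using assms by (auto simp: Z_up_def intro!: Bochner_Integration.integral_nonneg)

lemma renewal_solution_eq_Z:
  assumes x: "b < x" "x < a" and "renewal_solution a g h"
  shows "h i x = (\<Sum>k\<in>UNIV. ennreal (Z x a $ i $ k) * g k)"
proof -
  obtain T where "level_phase_epochs c lam p Q w b (P x i) X J x i T"
    using epochs_exist[of x i] x b_nonneg by auto
  then interpret level_phase_epochs c lam p Q w b "P x i" X J x i T .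
  have "\<forall>k. \<exists>H. renewal_solution a (indicator {k}) H"
    using renewal_solution_indicator_exists by blast
  then obtain H where H: "\<And>k. renewal_solution a (indicator {k}) (H k)"
    by metis
  then show ?thesis
    using renewal_solution_decomposition[OF assms H] Z_entry[OF x H] by simp
qed

lemma Z_mult:
  assumes "b < x" "x \<le> a'" "a' < a"
  shows "Z x a = Z x a' ** Z a' a"
proof (cases "x = a'")
  case True
  then show ?thesis
    using assms by (simp add: Z_up_def[of _ _ _ _ _ a' a'])
next
  case False
  then have x: "b < x" "x < a'" "x < a" "b < a'" using assms by auto
  have "Z x a $ i $ j = (Z x a' ** Z a' a) $ i $ j" for i j
  proof -
    obtain h where h: "renewal_solution a (indicator {j}) h"
      using renewal_solution_indicator_exists by blast
    \<comment> \<open>Here \<open>h\<close> is column \<open>j\<close> of the matrices for target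
      \<open>a\<close>. Read as a solution for target \<open>a'\<close>, its terminal vector is
      column \<open>j\<close> of \<open>Z a' a\<close>.\<close>
    then have "renewal_solution a' (\<lambda>k. h k a') h"
      using x assms by (intro renewal_solution_lower_end) auto
    then have "h i x = (\<Sum>k\<in>UNIV. ennreal (Z x a' $ i $ k) * h k a')"
      using x by (intro renewal_solution_eq_Z) auto
    then have "ennreal (Z x a $ i $ j) = (\<Sum>k\<in>UNIV. ennreal (Z x a' $ i $ k) * ennreal (Z a' a $ k $ j))"
      using Z_entry[OF _ _ h] x assms by simp
    also have "\<dots> = ennreal (\<Sum>k\<in>UNIV. Z x a' $ i $ k * Z a' a $ k $ j)"
      using x assms by (simp add: ennreal_mult' Z_nonneg sum_ennreal[symmetric])
    finally show ?thesis
      using x assms by (simp add: matrix_matrix_mult_def Z_nonneg sum_nonneg)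
  qed
  then show ?thesis by (simp add: vec_eq_iff)
qed

section \<open>Invertibility by short steps\<close>

lemma Z_row_sum_le_1:
  assumes x: "b < x" "x < a"
  shows "(\<Sum>j\<in>UNIV. Z x a $ i $ j) \<le> 1"
proof -
  obtain h where h: "renewal_solution a (\<lambda>_. 1) h"
    using renewal_solution_exists[of "\<lambda>_. 1"] by auto
  have "ennreal (\<Sum>j\<in>UNIV. Z x a $ i $ j) = h i x"
    using renewal_solution_eq_Z[OF x h] x by (simp add: Z_nonneg sum_ennreal)
  also have "\<dots> \<le> 1"
    using h by (simp add: renewal_solution_def)
  finally show ?thesis by simp
qed

lemma Z_diagonal_ge:
  assumes x: "b < x" "x < a"
  shows "exp (- (lam i + w) * (c i * (a - x))) \<le> Z x a $ i $ i"
proof -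
  obtain h where h: "renewal_solution a (indicator {i}) h"
    using renewal_solution_indicator_exists by blast
  have "ennreal (exp (- (lam i + w) * (c i * (a - x)))) \<le> ennreal (Z x a $ i $ i)"
    using renewal_solution_lower_bound[OF h, of x i] Z_entry[OF x h, of i] x by simp
  then show ?thesis
    using x by (simp add: Z_nonneg)
qed

text \<open>The constant \<open>ln 2\<close> makes each diagonal entry exceed 1/2. Rows are
  nonnegative with sum at most 1, so the remaining entries of a row sum to less than 1/2.\<close>

lemma invertible_Z_close:
  assumes x: "b < x" "x \<le> a" and close: "\<And>i. (lam i + w) * c i * (a - x) < ln 2"
  shows "invertible (Z x a)"
proof (cases "x = a")
  case True
  then have "Z x a = mat 1" using x by (simp add: Z_up_def)
  then show ?thesis
    unfolding invertible_def by (intro exI[of _ "mat 1"]) simp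
next
  case False
  then have x: "b < x" "x < a" using x by auto
  show ?thesis
  proof (rule invertible_diagonally_dominant)
    fix i
    have "exp (- ln 2) < exp (- (lam i + w) * (c i * (a - x)))"
      using close[of i] by (simp add: mult.assoc algebra_simps)
    then have "1 / 2 < Z x a $ i $ i"
      using Z_diagonal_ge[OF x, of i] by (simp add: exp_minus inverse_eq_divide)
    moreover have "(\<Sum>j\<in>UNIV. Z x a $ i $ j) = Z x a $ i $ i + (\<Sum>j\<in>UNIV - {i}. Z x a $ i $ j)"
      by (simp add: sum.remove)
    ultimately show "(\<Sum>j\<in>UNIV - {i}. \<bar>Z x a $ i $ j\<bar>) < \<bar>Z x a $ i $ i\<bar>"
      using Z_row_sum_le_1[OF x, of i] Z_nonneg[OF x] by simp
  qed
qed

lemma invertible_Z: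
  assumes "b < x" "x \<le> a"
  shows "invertible (Z x a)"
proof -
  define \<kappa> where "\<kappa> = (\<Sum>i\<in>UNIV. (lam i + w) * c i)"
  have pos: "0 < (lam i + w) * c i" for i
    using lam_pos[of i] w_pos c_pos[of i] by simp
  have \<kappa>: "(lam i + w) * c i \<le> \<kappa>" for i
    unfolding \<kappa>_def using pos by (intro member_le_sum) (auto simp: less_imp_le)
  then have "0 < \<kappa>"
    using pos by (meson less_le_trans)
  \<comment> \<open>The step length is uniform in level and phase; the factor 2 makes the bound by
    \<open>ln 2\<close> strict.\<close>
  define \<delta> where "\<delta> = ln 2 / (2 * \<kappa>)"
  have "0 < \<delta>"
    using \<open>0 < \<kappa>\<close> by (simp add: \<delta>_def)
  have close: "(lam i + w) * c i * d < ln 2" if "0 \<le> d" "d \<le> \<delta>" for i d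
  proof -
    have "(lam i + w) * c i * d \<le> \<kappa> * \<delta>"
      using \<kappa> that \<open>0 < \<kappa>\<close> by (intro mult_mono) auto
    also have "\<dots> < ln 2"
      using \<open>0 < \<kappa>\<close> by (simp add: \<delta>_def)
    finally show ?thesis .
  qed
  obtain n where "a - x \<le> real n * \<delta>"
    using reals_Archimedean3[OF \<open>0 < \<delta>\<close>] by (meson less_imp_le)
  then show ?thesis
    using assms
  proof (induction n arbitrary: x)
    case 0
    then show ?case using close[of 0] by (intro invertible_Z_close) auto
  next
    case (Suc n)
    show ?case
    proof (cases "a - x \<le> \<delta>")
      case True
      then show ?thesis using Suc.prems close by (intro invertible_Z_close) auto
    next
      case False
      have "invertible (Z x (x + \<delta>))"
        using Suc.prems \<open>0 < \<delta>\<close> close by (intro invertible_Z_close) auto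
      moreover have "invertible (Z (x + \<delta>) a)"
        using Suc.prems \<open>0 < \<delta>\<close> False by (intro Suc.IH) (auto simp: algebra_simps)
      \<comment> \<open>The remaining distance exceeds \<open>\<delta>\<close>, so the intermediate
        level is strictly below \<open>a\<close>, as \<open>Z_mult\<close> demands.\<close>
      moreover have "Z x a = Z x (x + \<delta>) ** Z (x + \<delta>) a"
        using Suc.prems \<open>0 < \<delta>\<close> False by (intro Z_mult) auto
      ultimately show ?thesis
        by (simp add: invertible_mult)
    qed
  qed
qed

end

theorem proposition5p2:
  fixes c lam p :: "'e::finite \<Rightarrow> real"
    and Q :: "real ^ 'e ^ 'e"
    and P :: "real \<Rightarrow> 'e \<Rightarrow> 'w measure"
    and X :: "real \<Rightarrow> 'w \<Rightarrow> real"
    and J :: "real \<Rightarrow> 'w \<Rightarrow> 'e"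
    and w b :: real
  assumes "\<forall>i. 0 < c i"
    and "\<forall>i. 0 < lam i"
    and "\<forall>i. 0 < p i \<and> p i < 1"
    and "stochastic_matrix Q"
    and "\<forall>x\<ge>0. \<forall>i. level_phase_process c lam p Q (P x i) X J x i"
    and "0 < w"
    and "0 \<le> b"
  shows "(\<forall>x a' a. b < x \<and> x \<le> a' \<and> a' < a \<longrightarrow>
            Z_up P X J w b x a = Z_up P X J w b x a' ** Z_up P X J w b a' a) \<and>
         (\<forall>x a. b < x \<and> x \<le> a \<longrightarrow> invertible (Z_up P X J w b x a))"
proof -
  interpret level_phase_family c lam p Q w b P X J
    using assms by unfold_locales auto
  show ?thesis
    using Z_mult invertible_Z by blast
qed

end
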